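(* Let $(M,\omega)$ be a compact connected Kähler manifold without boundary, of complex dimension $n$, and endow the space $\mathcal{C}$ of volume conformal factors with the constant weight metric $\langle G_1,G_2\rangle_{F;1}=\int_MG_1G_2\frac{\omega^n}{n!}$. For any given $F_0,F_1\in\mathcal{C}$ there is a unique geodesic arc (parametrized by $[0,1]$) connecting $F_0$ and $F_1$; it is given by $$F(t)=tF_1+(1-t)F_0\in\mathcal{C},\qquad t\in[0,1].$$ For any $F\in\mathcal{C}$ and any $G\in T_F\mathcal{C}$, the geodesic line starting at $F$ with speed $G$ is given by $$F(t)=F+tG,$$ where $t$ ranges in a suitable open neighborhood of $0$ such that $F(t)>0$.
   Context: $\mathcal{C}=\{F\in C^\infty(M,\mathbb{R}): F>0,\ \int_MF\omega^n=\int_M\omega^n\}$, with tangent space $T_F\mathcal{C}=\{G\in C^\infty(M,\mathbb{R}):\int_MG\,\omega^n=0\}$. The Levi-Civita covariant derivative $D$ of a Riemannian metric on $\mathcal{C}$ is the unique covariant derivative of smooth vector fields along smooth curves in $\mathcal{C}$ that is additive, satisfies the Leibniz rule, is compatible with the metric and is torsion free ($D_tF_s=D_sF_t$ for smooth two-parameter families). A geodesic is a smooth curve $F(t)$ in $\mathcal{C}$ with $D_tF_t=0$. *)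

theory Defs
  imports "HOL-Analysis.Analysis"
begin

section \<open>Smooth and holomorphic maps in coordinates\<close>

text \<open>Derivatives are taken within \<open>S\<close>, so that one-sided derivatives are used at the end points of a
  time interval. The predicate is only used where derivatives within \<open>S\<close> are unique: for open sets,
  nondegenerate intervals and products of these.\<close>

fun Ck_on :: "nat \<Rightarrow> 'e::euclidean_space set \<Rightarrow> ('e \<Rightarrow> real) \<Rightarrow> bool" where
  "Ck_on 0 S f \<longleftrightarrow> continuous_on S f"
| "Ck_on (Suc k) S f \<longleftrightarrow>
     (\<exists>f'. (\<forall>x\<in>S. (f has_derivative f' x) (at x within S)) \<and> (\<forall>v. Ck_on k S (\<lambda>x. f' x v)))"

definition smooth_on :: "'e::euclidean_space set \<Rightarrow> ('e \<Rightarrow> real) \<Rightarrow> bool" where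
  "smooth_on S f \<longleftrightarrow> (\<forall>k. Ck_on k S f)"

definition holomorphic_map_on :: "(complex^'n) set \<Rightarrow> (complex^'n \<Rightarrow> complex^'n) \<Rightarrow> bool" where
  "holomorphic_map_on S f \<longleftrightarrow>
     (\<forall>x\<in>S. \<exists>f'. (f has_derivative f') (at x) \<and> (\<forall>a v. f' (a *s v) = a *s f' v))"

section \<open>Complex manifolds\<close>

text \<open>The underlying space \<open>M\<close> is the type \<open>'a\<close>; its complex dimension is \<open>CARD('n)\<close>.
  A chart is a pair of a domain and a coordinate map.\<close>

type_synonym ('a, 'n) chart = "'a set \<times> ('a \<Rightarrow> complex^'n)"

abbreviation chart_image :: "('a, 'n) chart \<Rightarrow> (complex^'n) set" where
  "chart_image c \<equiv> snd c ` fst c"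

abbreviation chart_inv :: "('a, 'n) chart \<Rightarrow> complex^'n \<Rightarrow> 'a" where
  "chart_inv c \<equiv> inv_into (fst c) (snd c)"

definition is_chart :: "('a::topological_space, 'n::finite) chart \<Rightarrow> bool" where
  "is_chart c \<longleftrightarrow> open (fst c) \<and> open (chart_image c) \<and>
     homeomorphism (fst c) (chart_image c) (snd c) (chart_inv c)"

definition complex_atlas :: "('a::topological_space, 'n::finite) chart set \<Rightarrow> bool" where
  "complex_atlas \<A> \<longleftrightarrow>
     (\<forall>c\<in>\<A>. is_chart c) \<and> (\<Union>c\<in>\<A>. fst c) = UNIV \<and>
     (\<forall>c\<in>\<A>. \<forall>d\<in>\<A>. holomorphic_map_on (snd c ` (fst c \<inter> fst d)) (snd d \<circ> chart_inv c))"

text \<open>A family of functions on \<open>M\<close> with parameters in \<open>S\<close> is smooth if it is jointly smooth on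
  \<open>S \<times> M\<close>; this is the notion of smooth curve, and of smooth two-parameter family, of functions.\<close>

definition smooth_family ::
  "('a, 'n::finite) chart set \<Rightarrow> 'p::euclidean_space set \<Rightarrow> ('p \<Rightarrow> 'a \<Rightarrow> real) \<Rightarrow> bool" where
  "smooth_family \<A> S F \<longleftrightarrow>
     (\<forall>c\<in>\<A>. smooth_on (S \<times> chart_image c) (\<lambda>(t, z). F t (chart_inv c z)))"

definition smooth_fun :: "('a, 'n::finite) chart set \<Rightarrow> ('a \<Rightarrow> real) \<Rightarrow> bool" where
  "smooth_fun \<A> f \<longleftrightarrow> (\<forall>c\<in>\<A>. smooth_on (chart_image c) (f \<circ> chart_inv c))"

section \<open>Kaehler forms\<close>

text \<open>A 2-form is given by its coordinate representations: \<open>\<omega> c z u v\<close> is the value on the vectors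
  \<open>u\<close>, \<open>v\<close>, expressed in the chart \<open>c\<close>, at the point with coordinates \<open>z\<close>. The representations
  are related by pullback along the transition maps. The complex structure is
  multiplication by \<open>\<i>\<close>.\<close>

type_synonym ('a, 'n) two_form = "('a, 'n) chart \<Rightarrow> complex^'n \<Rightarrow> complex^'n \<Rightarrow> complex^'n \<Rightarrow> real"

definition smooth_two_form ::
  "('a, 'n::finite) chart set \<Rightarrow> ('a, 'n) two_form \<Rightarrow> bool" where
  "smooth_two_form \<A> \<omega> \<longleftrightarrow>
     (\<forall>c\<in>\<A>. \<forall>z\<in>chart_image c. bilinear (\<omega> c z) \<and> (\<forall>v. \<omega> c z v v = 0)) \<and>
     (\<forall>c\<in>\<A>. \<forall>u v. smooth_on (chart_image c) (\<lambda>z. \<omega> c z u v)) \<and>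
     (\<forall>c\<in>\<A>. \<forall>d\<in>\<A>. \<forall>z\<in>snd c ` (fst c \<inter> fst d). \<forall>u v.
        let \<tau> = snd d \<circ> chart_inv c; \<tau>' = frechet_derivative \<tau> (at z)
        in \<omega> c z u v = \<omega> d (\<tau> z) (\<tau>' u) (\<tau>' v))"

definition closed_two_form ::
  "('a, 'n::finite) chart set \<Rightarrow> ('a, 'n) two_form \<Rightarrow> bool" where
  "closed_two_form \<A> \<omega> \<longleftrightarrow>
     (\<forall>c\<in>\<A>. \<forall>z\<in>chart_image c. \<forall>u v w.
        frechet_derivative (\<lambda>y. \<omega> c y v w) (at z) u
      + frechet_derivative (\<lambda>y. \<omega> c y w u) (at z) v
      + frechet_derivative (\<lambda>y. \<omega> c y u v) (at z) w = 0)"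

definition positive_one_one_form ::
  "('a, 'n::finite) chart set \<Rightarrow> ('a, 'n) two_form \<Rightarrow> bool" where
  "positive_one_one_form \<A> \<omega> \<longleftrightarrow>
     (\<forall>c\<in>\<A>. \<forall>z\<in>chart_image c.
        (\<forall>u v. \<omega> c z (\<i> *s u) (\<i> *s v) = \<omega> c z u v) \<and>
        (\<forall>v. v \<noteq> 0 \<longrightarrow> \<omega> c z v (\<i> *s v) > 0))"

definition kaehler_manifold ::
  "('a::t2_space, 'n::finite) chart set \<Rightarrow> ('a, 'n) two_form \<Rightarrow> bool" where
  "kaehler_manifold \<A> \<omega> \<longleftrightarrow>
     complex_atlas \<A> \<and> smooth_two_form \<A> \<omega> \<and> closed_two_form \<A> \<omega> \<and> positive_one_one_form \<A> \<omega>"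

section \<open>Integration against the top exterior power\<close>

text \<open>The \<open>n\<close>-fold wedge power of an alternating bilinear form, evaluated on \<open>2n\<close> vectors indexed by
  \<open>'n \<times> bool\<close>. The pairs \<open>(k, False), (k, True)\<close> are consecutive; the order of the pairs does
  not matter, since permuting pairs is an even permutation. The normalisation is the one with
  \<open>(\<alpha> \<and> \<beta>)(u, v) = \<alpha> u * \<beta> v - \<alpha> v * \<beta> u\<close> for 1-forms.\<close>

definition wedge_power ::
  "(complex^'n \<Rightarrow> complex^'n \<Rightarrow> real) \<Rightarrow> ('n::finite \<times> bool \<Rightarrow> complex^'n) \<Rightarrow> real" where
  "wedge_power \<alpha> v =
     (\<Sum>\<sigma> | \<sigma> permutes UNIV.
        of_int (sign \<sigma>) * (\<Prod>k\<in>UNIV. \<alpha> (v (\<sigma> (k, False))) (v (\<sigma> (k, True))))) / 2 ^ CARD('n)"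

text \<open>With \<open>z\<^sub>k = x\<^sub>k + \<i> y\<^sub>k\<close>, the vectors below are \<open>\<partial>/\<partial>x\<^sub>k\<close> and \<open>\<partial>/\<partial>y\<^sub>k\<close>, so \<open>omega_power \<omega> c z\<close> is
  the coefficient of \<open>\<omega>\<^sup>n\<close> with respect to \<open>dx\<^sub>1 \<and> dy\<^sub>1 \<and> \<dots> \<and> dx\<^sub>n \<and> dy\<^sub>n\<close>.\<close>

definition omega_power ::
  "('a, 'n::finite) two_form \<Rightarrow> ('a, 'n) chart \<Rightarrow> complex^'n \<Rightarrow> real" where
  "omega_power \<omega> c z = wedge_power (\<omega> c z) (\<lambda>(k, b). axis k (if b then \<i> else 1))"

definition partition_of_unity ::
  "('a::topological_space, 'n::finite) chart set \<Rightarrow> ('a, 'n) chart set \<Rightarrow>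
   (('a, 'n) chart \<Rightarrow> 'a \<Rightarrow> real) \<Rightarrow> bool" where
  "partition_of_unity \<A> B \<rho> \<longleftrightarrow>
     finite B \<and> B \<subseteq> \<A> \<and>
     (\<forall>c\<in>B. continuous_on UNIV (\<rho> c) \<and> (\<forall>p. 0 \<le> \<rho> c p) \<and> closure {p. \<rho> c p \<noteq> 0} \<subseteq> fst c) \<and>
     (\<forall>p. (\<Sum>c\<in>B. \<rho> c p) = 1)"

text \<open>The integral of \<open>f \<omega>\<^sup>n\<close> over compact \<open>M\<close>. As usual it does not depend on the partition of unity;
  continuity of the partition suffices for integration.\<close>

definition integral_omega_power ::
  "('a::topological_space, 'n::finite) chart set \<Rightarrow> ('a, 'n) two_form \<Rightarrow> ('a \<Rightarrow> real) \<Rightarrow> real" where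
  "integral_omega_power \<A> \<omega> f =
     (let (B, \<rho>) = (SOME (B, \<rho>). partition_of_unity \<A> B \<rho>)
      in \<Sum>c\<in>B. LINT z:chart_image c|lborel.
           \<rho> c (chart_inv c z) * f (chart_inv c z) * omega_power \<omega> c z)"

section \<open>The space of volume conformal factors\<close>

definition conformal_factors ::
  "('a::topological_space, 'n::finite) chart set \<Rightarrow> ('a, 'n) two_form \<Rightarrow> ('a \<Rightarrow> real) set" where
  "conformal_factors \<A> \<omega> =
     {F. smooth_fun \<A> F \<and> (\<forall>p. F p > 0) \<and>
         integral_omega_power \<A> \<omega> F = integral_omega_power \<A> \<omega> (\<lambda>_. 1)}"

text \<open>The tangent space does not depend on the base point.\<close>

definition tangent_factors ::
  "('a::topological_space, 'n::finite) chart set \<Rightarrow> ('a, 'n) two_form \<Rightarrow> ('a \<Rightarrow> real) set" where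
  "tangent_factors \<A> \<omega> = {G. smooth_fun \<A> G \<and> integral_omega_power \<A> \<omega> G = 0}"

text \<open>A metric takes a base point and two tangent vectors.\<close>

type_synonym 'a factor_metric = "('a \<Rightarrow> real) \<Rightarrow> ('a \<Rightarrow> real) \<Rightarrow> ('a \<Rightarrow> real) \<Rightarrow> real"

definition constant_weight_metric ::
  "('a::topological_space, 'n::finite) chart set \<Rightarrow> ('a, 'n) two_form \<Rightarrow> 'a factor_metric" where
  "constant_weight_metric \<A> \<omega> F G\<^sub>1 G\<^sub>2 =
     integral_omega_power \<A> \<omega> (\<lambda>p. G\<^sub>1 p * G\<^sub>2 p) / fact CARD('n)"

definition time_interval :: "real set \<Rightarrow> bool" where
  "time_interval I \<longleftrightarrow> is_interval I \<and> interior I \<noteq> {}"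

definition smooth_curve ::
  "('a::topological_space, 'n::finite) chart set \<Rightarrow> ('a, 'n) two_form \<Rightarrow> real set \<Rightarrow>
   (real \<Rightarrow> 'a \<Rightarrow> real) \<Rightarrow> bool" where
  "smooth_curve \<A> \<omega> I F \<longleftrightarrow>
     time_interval I \<and> smooth_family \<A> I F \<and> (\<forall>t\<in>I. F t \<in> conformal_factors \<A> \<omega>)"

text \<open>The tangent spaces being the same at all points, a vector field along a curve involves only
  the time interval of the curve.\<close>

definition smooth_field ::
  "('a::topological_space, 'n::finite) chart set \<Rightarrow> ('a, 'n) two_form \<Rightarrow> real set \<Rightarrow>
   (real \<Rightarrow> 'a \<Rightarrow> real) \<Rightarrow> bool" where
  "smooth_field \<A> \<omega> I V \<longleftrightarrow> smooth_family \<A> I V \<and> (\<forall>t\<in>I. V t \<in> tangent_factors \<A> \<omega>)"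

definition velocity :: "real set \<Rightarrow> (real \<Rightarrow> 'a \<Rightarrow> real) \<Rightarrow> real \<Rightarrow> 'a \<Rightarrow> real" where
  "velocity I F t p = vector_derivative (\<lambda>s. F s p) (at t within I)"

section \<open>The Levi-Civita covariant derivative and geodesics\<close>

text \<open>\<open>D I F V\<close> is the covariant derivative of the field \<open>V\<close> along the curve \<open>F\<close> on the interval \<open>I\<close>.\<close>

type_synonym 'a covariant_derivative =
  "real set \<Rightarrow> (real \<Rightarrow> 'a \<Rightarrow> real) \<Rightarrow> (real \<Rightarrow> 'a \<Rightarrow> real) \<Rightarrow> real \<Rightarrow> 'a \<Rightarrow> real"

definition additive_derivative ::
  "('a::topological_space, 'n::finite) chart set \<Rightarrow> ('a, 'n) two_form \<Rightarrow>
   'a covariant_derivative \<Rightarrow> bool" where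
  "additive_derivative \<A> \<omega> D \<longleftrightarrow>
     (\<forall>I F V W. smooth_curve \<A> \<omega> I F \<and> smooth_field \<A> \<omega> I V \<and> smooth_field \<A> \<omega> I W \<longrightarrow>
        (\<forall>t\<in>I. \<forall>p. D I F (\<lambda>s q. V s q + W s q) t p = D I F V t p + D I F W t p))"

definition leibniz_derivative ::
  "('a::topological_space, 'n::finite) chart set \<Rightarrow> ('a, 'n) two_form \<Rightarrow>
   'a covariant_derivative \<Rightarrow> bool" where
  "leibniz_derivative \<A> \<omega> D \<longleftrightarrow>
     (\<forall>I F V h. smooth_curve \<A> \<omega> I F \<and> smooth_field \<A> \<omega> I V \<and> smooth_on I h \<longrightarrow>
        (\<forall>t\<in>I. \<forall>p. D I F (\<lambda>s q. h s * V s q) t p =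
           vector_derivative h (at t within I) * V t p + h t * D I F V t p))"

definition metric_derivative ::
  "('a::topological_space, 'n::finite) chart set \<Rightarrow> ('a, 'n) two_form \<Rightarrow>
   'a factor_metric \<Rightarrow> 'a covariant_derivative \<Rightarrow> bool" where
  "metric_derivative \<A> \<omega> g D \<longleftrightarrow>
     (\<forall>I F V W. smooth_curve \<A> \<omega> I F \<and> smooth_field \<A> \<omega> I V \<and> smooth_field \<A> \<omega> I W \<longrightarrow>
        (\<forall>t\<in>I. ((\<lambda>s. g (F s) (V s) (W s)) has_real_derivative
                  g (F t) (D I F V t) (W t) + g (F t) (V t) (D I F W t)) (at t within I)))"

definition torsion_free_derivative ::
  "('a::topological_space, 'n::finite) chart set \<Rightarrow> ('a, 'n) two_form \<Rightarrow>
   'a covariant_derivative \<Rightarrow> bool" where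
  "torsion_free_derivative \<A> \<omega> D \<longleftrightarrow>
     (\<forall>I J F. time_interval I \<and> time_interval J \<and>
        smooth_family \<A> (I \<times> J) (\<lambda>(t, s). F t s) \<and>
        (\<forall>t\<in>I. \<forall>s\<in>J. F t s \<in> conformal_factors \<A> \<omega>) \<longrightarrow>
        (\<forall>t\<in>I. \<forall>s\<in>J.
           D I (\<lambda>t'. F t' s) (\<lambda>t'. velocity J (F t') s) t =
           D J (F t) (\<lambda>s'. velocity I (\<lambda>t'. F t' s') t) s))"

text \<open>The last clause fixes the value \<open>0\<close> outside the intended domain, so that the Levi-Civita
  derivative is unique as a total function.\<close>

definition is_levi_civita ::
  "('a::topological_space, 'n::finite) chart set \<Rightarrow> ('a, 'n) two_form \<Rightarrow>
   'a factor_metric \<Rightarrow> 'a covariant_derivative \<Rightarrow> bool" where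
  "is_levi_civita \<A> \<omega> g D \<longleftrightarrow>
     (\<forall>I F V. smooth_curve \<A> \<omega> I F \<and> smooth_field \<A> \<omega> I V \<longrightarrow> smooth_field \<A> \<omega> I (D I F V)) \<and>
     additive_derivative \<A> \<omega> D \<and> leibniz_derivative \<A> \<omega> D \<and>
     metric_derivative \<A> \<omega> g D \<and> torsion_free_derivative \<A> \<omega> D \<and>
     (\<forall>I F V t. \<not> (smooth_curve \<A> \<omega> I F \<and> smooth_field \<A> \<omega> I V \<and> t \<in> I) \<longrightarrow> D I F V t = (\<lambda>_. 0))"

definition levi_civita ::
  "('a::topological_space, 'n::finite) chart set \<Rightarrow> ('a, 'n) two_form \<Rightarrow>
   'a factor_metric \<Rightarrow> 'a covariant_derivative" where
  "levi_civita \<A> \<omega> g = (THE D. is_levi_civita \<A> \<omega> g D)"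

definition geodesic ::
  "('a::topological_space, 'n::finite) chart set \<Rightarrow> ('a, 'n) two_form \<Rightarrow>
   'a factor_metric \<Rightarrow> real set \<Rightarrow> (real \<Rightarrow> 'a \<Rightarrow> real) \<Rightarrow> bool" where
  "geodesic \<A> \<omega> g I F \<longleftrightarrow>
     smooth_curve \<A> \<omega> I F \<and> (\<forall>t\<in>I. levi_civita \<A> \<omega> g I F (velocity I F) t = (\<lambda>_. 0))"

end

theory Submission imports Defs begin

text \<open>The constant weight metric does not depend on its base point, so \<open>\<C>\<close> is a convex piece of an
  affine space with a flat metric. Its Levi-Civita derivative is the plain time derivative of
  fields, geodesics are the curves with vanishing second time derivative, and these are the
  straight lines. The substance lies in showing that the plain time derivative is the only
  Levi-Civita derivative.

  That the time derivative is one needs differentiation under the integral over \<open>M\<close>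
  (\<open>has_derivative_integral\<close>), for tangency and compatibility with the metric, and the symmetry of
  mixed partial derivatives (\<open>mixed_partials_commute\<close>), for torsion freeness.

  For uniqueness let \<open>A\<close> be the difference of a Levi-Civita derivative and the time
  derivative. Compatibility with the metric makes \<open>A\<close> skew with respect to the \<open>L\<^sup>2\<close> product, and
  the product is definite, so \<open>A\<close> along \<open>F\<close> at time \<open>t\<close> only depends on the value of the field
  at \<open>t\<close> (\<open>difference_tensorial\<close>). A priori it may still depend on all of the curve \<open>F\<close>. Torsion
  freeness, applied to a variation of \<open>F\<close> whose transversal curve at time \<open>t\<close> is a straight line, reduces
  this to straight lines (\<open>difference_variation\<close>). There \<open>A\<close> defines a trilinear form that is
  symmetric in the first two and skew in the last two arguments, and such a form vanishes
  (\<open>difference_line_zero\<close>).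

  Definiteness of the \<open>L\<^sup>2\<close> product (\<open>integral_definite\<close>) rests on two facts: a continuous partition of
  unity exists on the compact manifold (\<open>partition_of_unity_exists\<close>), and \<open>\<omega>\<^sup>n\<close> is a positive
  multiple of the coordinate volume form (\<open>wedge_power_positive\<close>).\<close>

section \<open>Calculus of smooth functions\<close>

lemma Ck_on_cong:
  assumes "\<And>x. x \<in> S \<Longrightarrow> f x = g x" and "Ck_on k S f"
  shows "Ck_on k S g"
proof (cases k)
  case 0
  then show ?thesis using assms by (simp cong: continuous_on_cong)
next
  case (Suc j)
  then obtain f' where f': "\<forall>x\<in>S. (f has_derivative f' x) (at x within S)"
      "\<forall>v. Ck_on j S (\<lambda>x. f' x v)"
    using assms(2) by auto
  have "\<forall>x\<in>S. (g has_derivative f' x) (at x within S)"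
    using f'(1) assms(1) by (metis has_derivative_transform)
  then show ?thesis using Suc f'(2) by auto
qed

lemma Ck_on_Suc_imp: "Ck_on (Suc k) S f \<Longrightarrow> Ck_on k S f"
proof (induction k arbitrary: f)
  case 0
  then show ?case
    by (auto simp: continuous_on_eq_continuous_within intro: has_derivative_continuous)
next
  case (Suc k)
  then obtain f' where f': "\<forall>x\<in>S. (f has_derivative f' x) (at x within S)"
      "\<forall>v. Ck_on (Suc k) S (\<lambda>x. f' x v)"
    unfolding Ck_on.simps(2)[of "Suc k"] by blast
  then show ?case using Suc.IH unfolding Ck_on.simps(2)[of k] by blast
qed

lemma Ck_on_const: "Ck_on k S (\<lambda>_. c)"
  by (induction k arbitrary: c) (auto intro!: exI[of _ "\<lambda>_ _. 0"])

lemma Ck_on_add: "Ck_on k S f \<Longrightarrow> Ck_on k S g \<Longrightarrow> Ck_on k S (\<lambda>x. f x + g x)"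
proof (induction k arbitrary: f g)
  case 0
  then show ?case by (auto intro: continuous_intros)
next
  case (Suc k)
  from Suc.prems obtain f' g'
    where "\<forall>x\<in>S. (f has_derivative f' x) (at x within S)" "\<forall>v. Ck_on k S (\<lambda>x. f' x v)"
      and "\<forall>x\<in>S. (g has_derivative g' x) (at x within S)" "\<forall>v. Ck_on k S (\<lambda>x. g' x v)"
    by auto
  then show ?case using Suc.IH
    by (auto intro!: exI[of _ "\<lambda>x v. f' x v + g' x v"] derivative_intros)
qed

lemma Ck_on_mult: "Ck_on k S f \<Longrightarrow> Ck_on k S g \<Longrightarrow> Ck_on k S (\<lambda>x. f x * g x)"
proof (induction k arbitrary: f g)
  case 0
  then show ?case by (auto intro: continuous_intros)
next
  case (Suc k)
  from Suc.prems obtain f' g'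
    where *: "\<forall>x\<in>S. (f has_derivative f' x) (at x within S)" "\<forall>v. Ck_on k S (\<lambda>x. f' x v)"
      "\<forall>x\<in>S. (g has_derivative g' x) (at x within S)" "\<forall>v. Ck_on k S (\<lambda>x. g' x v)"
    by auto
  have "Ck_on k S f" "Ck_on k S g"
    using Suc.prems by (blast intro: Ck_on_Suc_imp)+
  then have "\<forall>v. Ck_on k S (\<lambda>x. f x * g' x v + f' x v * g x)"
    using * Suc.IH by (auto intro!: Ck_on_add)
  moreover have "\<forall>x\<in>S. ((\<lambda>x. f x * g x) has_derivative (\<lambda>v. f x * g' x v + f' x v * g x)) (at x within S)"
    using * by (auto intro!: has_derivative_mult)
  ultimately show ?case
    unfolding Ck_on.simps(2) by (intro exI[of _ "\<lambda>x v. f x * g' x v + f' x v * g x"] conjI)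
qed

lemma Ck_on_compose_affine:
  assumes L: "bounded_linear L" and sub: "\<And>x. x \<in> T \<Longrightarrow> L x + c \<in> S"
  shows "Ck_on k S f \<Longrightarrow> Ck_on k T (\<lambda>x. f (L x + c))"
proof (induction k arbitrary: f)
  case 0
  have "continuous_on T (\<lambda>x. L x + c)"
    using L by (intro continuous_intros linear_continuous_on)
  then show ?case using 0 sub
    by (auto intro!: continuous_on_compose2[of S f])
next
  case (Suc k)
  then obtain f' where f': "\<forall>x\<in>S. (f has_derivative f' x) (at x within S)"
      "\<forall>v. Ck_on k S (\<lambda>x. f' x v)"
    by auto
  have "((\<lambda>x. f (L x + c)) has_derivative (\<lambda>v. f' (L x + c) (L v))) (at x within T)" if "x \<in> T" for x
  proof -
    have d: "((\<lambda>x. L x + c) has_derivative L) (at x within T)"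
      using bounded_linear_imp_has_derivative[OF L] by (auto intro!: derivative_eq_intros)
    have "(f has_derivative f' (L x + c)) (at (L x + c) within (\<lambda>x. L x + c) ` T)"
      using f'(1) sub that by (auto intro: has_derivative_subset)
    from has_derivative_in_compose[OF d this] show ?thesis .
  qed
  moreover have "\<forall>v. Ck_on k T (\<lambda>x. f' (L x + c) (L v))"
    using f'(2) Suc.IH by blast
  ultimately show ?case
    unfolding Ck_on.simps(2) by (intro exI[of _ "\<lambda>x v. f' (L x + c) (L v)"]) auto
qed

lemma Ck_on_inverse:
  assumes "\<And>x. x \<in> S \<Longrightarrow> f x \<noteq> 0"
  shows "Ck_on k S f \<Longrightarrow> Ck_on k S (\<lambda>x. inverse (f x))"
proof (induction k)
  case 0
  then show ?case using assms by (auto intro!: continuous_intros)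
next
  case (Suc k)
  then obtain f' where f': "\<forall>x\<in>S. (f has_derivative f' x) (at x within S)"
      "\<forall>v. Ck_on k S (\<lambda>x. f' x v)"
    by auto
  have "Ck_on k S (\<lambda>x. inverse (f x))"
    using Suc by (blast intro: Ck_on_Suc_imp)
  then have "\<forall>v. Ck_on k S (\<lambda>x. (-1) * (inverse (f x) * f' x v * inverse (f x)))"
    using f'(2) by (intro allI Ck_on_mult Ck_on_const) auto
  moreover have "\<forall>x\<in>S. ((\<lambda>x. inverse (f x)) has_derivative
      (\<lambda>v. (-1) * (inverse (f x) * f' x v * inverse (f x)))) (at x within S)"
    using f'(1) assms has_derivative_inverse by fastforce
  ultimately show ?case
    unfolding Ck_on.simps(2)
    by (intro exI[of _ "\<lambda>x v. (-1) * (inverse (f x) * f' x v * inverse (f x))"] conjI)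
qed

lemma smooth_on_cong:
  "(\<And>x. x \<in> S \<Longrightarrow> f x = g x) \<Longrightarrow> smooth_on S f \<Longrightarrow> smooth_on S g"
  unfolding smooth_on_def by (meson Ck_on_cong)

lemma smooth_on_const: "smooth_on S (\<lambda>_. c)"
  by (simp add: smooth_on_def Ck_on_const)

lemma smooth_on_add: "smooth_on S f \<Longrightarrow> smooth_on S g \<Longrightarrow> smooth_on S (\<lambda>x. f x + g x)"
  by (simp add: smooth_on_def Ck_on_add)

lemma smooth_on_mult: "smooth_on S f \<Longrightarrow> smooth_on S g \<Longrightarrow> smooth_on S (\<lambda>x. f x * g x)"
  by (simp add: smooth_on_def Ck_on_mult)

lemma smooth_on_inverse:
  "smooth_on S f \<Longrightarrow> (\<And>x. x \<in> S \<Longrightarrow> f x \<noteq> 0) \<Longrightarrow> smooth_on S (\<lambda>x. inverse (f x))"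
  by (simp add: smooth_on_def Ck_on_inverse)

lemma smooth_on_compose_affine:
  "bounded_linear L \<Longrightarrow> (\<And>x. x \<in> T \<Longrightarrow> L x + c \<in> S) \<Longrightarrow> smooth_on S f \<Longrightarrow>
   smooth_on T (\<lambda>x. f (L x + c))"
  unfolding smooth_on_def by (blast intro: Ck_on_compose_affine)

lemma smooth_on_imp_continuous_on: "smooth_on S f \<Longrightarrow> continuous_on S f"
  unfolding smooth_on_def by (metis Ck_on.simps(1))

lemma smooth_on_bounded_linear:
  assumes "bounded_linear f"
  shows "smooth_on S f"
  unfolding smooth_on_def
proof
  fix k
  show "Ck_on k S f"
  proof (cases k)
    case 0
    then show ?thesis using assms by (simp add: linear_continuous_on)
  next
    case (Suc j)
    then show ?thesis
      using bounded_linear_imp_has_derivative[OF assms]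
      by (auto intro!: exI[of _ "\<lambda>_. f"] simp: Ck_on_const)
  qed
qed

text \<open>Derivatives within such a set are unique. The condition holds for open sets and for time
  intervals and passes to products, which covers all parameter domains below.\<close>

definition axis_movable :: "'e::euclidean_space set \<Rightarrow> bool" where
  "axis_movable S \<longleftrightarrow> (\<forall>x\<in>S. \<forall>i\<in>Basis. \<forall>e>0. \<exists>d. 0 < \<bar>d\<bar> \<and> \<bar>d\<bar> < e \<and> x + d *\<^sub>R i \<in> S)"

lemma axis_movable_open:
  fixes S :: "'e::euclidean_space set"
  assumes "open S" shows "axis_movable S"
  unfolding axis_movable_def
proof (intro ballI allI impI)
  fix x i :: 'e and e :: real assume "x \<in> S" "i \<in> Basis" "e > 0"
  obtain r where r: "r > 0" "ball x r \<subseteq> S" using assms \<open>x \<in> S\<close> openE by blast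
  define d where "d = min r e / 2"
  have "d > 0" "d < r" "d < e" using r(1) \<open>e > 0\<close> by (auto simp: d_def min_def)
  moreover have "x + d *\<^sub>R i \<in> ball x r"
    using \<open>i \<in> Basis\<close> \<open>d > 0\<close> \<open>d < r\<close> by (simp add: dist_norm)
  ultimately show "\<exists>d. 0 < \<bar>d\<bar> \<and> \<bar>d\<bar> < e \<and> x + d *\<^sub>R i \<in> S"
    using r(2) by (intro exI[of _ d]) auto
qed

lemma axis_movable_Times:
  assumes "axis_movable S" "axis_movable T" shows "axis_movable (S \<times> T)"
  using assms unfolding axis_movable_def Basis_prod_def
  by (fastforce simp: ball_Un)

lemma time_interval_other_point:
  assumes "time_interval I" obtains x where "x \<in> I" "x \<noteq> t"
proof -
  obtain y where "y \<in> interior I" using assms by (auto simp: time_interval_def)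
  then obtain e where "e > 0" "ball y e \<subseteq> I" by (auto simp: mem_interior)
  then have "y \<in> I" "y + e/2 \<in> I" by (auto simp: subset_iff dist_real_def)
  then show thesis using that \<open>e > 0\<close> by (cases "y = t") auto
qed

lemma axis_movable_time_interval:
  assumes "time_interval I" shows "axis_movable I"
  unfolding axis_movable_def
proof (intro ballI allI impI)
  fix t i e :: real assume "t \<in> I" "i \<in> Basis" "e > 0"
  obtain x where x: "x \<in> I" "x \<noteq> t" using time_interval_other_point[OF assms] .
  have convex: "convex I" using assms by (simp add: time_interval_def is_interval_convex)
  define u where "u = min 1 (e / (2 * \<bar>x - t\<bar>))"
  have u: "0 < u" "u \<le> 1" using x \<open>e > 0\<close> by (auto simp: u_def)
  have "u * \<bar>x - t\<bar> \<le> e / (2 * \<bar>x - t\<bar>) * \<bar>x - t\<bar>"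
    by (intro mult_right_mono) (auto simp: u_def)
  also have "\<dots> < e" using x \<open>e > 0\<close> by simp
  finally have lt: "u * \<bar>x - t\<bar> < e" .
  have "(1 - u) *\<^sub>R t + u *\<^sub>R x \<in> I"
    using convexD_alt[OF convex \<open>t \<in> I\<close> x(1)] u by simp
  then have "t + u * (x - t) \<in> I" by (simp add: algebra_simps)
  then show "\<exists>d. 0 < \<bar>d\<bar> \<and> \<bar>d\<bar> < e \<and> t + d *\<^sub>R i \<in> I"
    using \<open>i \<in> Basis\<close> u x lt
    by (intro exI[of _ "u * (x - t)"]) (auto simp: abs_mult)
qed

lemma axis_movable_derivative_unique:
  assumes "axis_movable S" "x \<in> S"
    and "(f has_derivative f1) (at x within S)" "(f has_derivative f2) (at x within S)"
  shows "f1 = f2"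
  using assms frechet_derivative_unique_within[of f f1 x S f2]
  unfolding axis_movable_def by blast

text \<open>The definition of smoothness only provides, for each order, some derivative with enough
  regularity; since derivatives are unique these are all the same.\<close>

lemma smooth_on_derivative:
  assumes mov: "axis_movable S" and sm: "smooth_on S f"
  obtains f' where "\<And>x. x \<in> S \<Longrightarrow> (f has_derivative f' x) (at x within S)"
    and "\<And>v. smooth_on S (\<lambda>x. f' x v)"
proof -
  have Ck: "\<exists>f'. (\<forall>x\<in>S. (f has_derivative f' x) (at x within S)) \<and> (\<forall>v. Ck_on k S (\<lambda>x. f' x v))" for k
    using sm unfolding smooth_on_def Ck_on.simps(2)[symmetric] by blast
  obtain f' where f': "\<forall>x\<in>S. (f has_derivative f' x) (at x within S)"
    using Ck by blast
  have "Ck_on k S (\<lambda>x. f' x v)" for k v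
  proof -
    obtain f'' where f'': "\<forall>x\<in>S. (f has_derivative f'' x) (at x within S)"
        "\<forall>v. Ck_on k S (\<lambda>x. f'' x v)"
      using Ck by blast
    have "f'' x = f' x" if "x \<in> S" for x
      using axis_movable_derivative_unique[OF mov that] f' f''(1) that by blast
    then show ?thesis using f''(2) Ck_on_cong[of S "\<lambda>x. f'' x v"] by auto
  qed
  then have "smooth_on S (\<lambda>x. f' x v)" for v by (simp add: smooth_on_def)
  then show thesis using that f' by blast
qed

lemma vector_derivative_unique_time_interval:
  assumes "time_interval I" "t \<in> I"
    and "(f has_vector_derivative a) (at t within I)" "(f has_vector_derivative b) (at t within I)"
  shows "a = (b :: real)"
proof -
  have "(\<lambda>x. x *\<^sub>R a) = (\<lambda>x. x *\<^sub>R b)"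
    using axis_movable_derivative_unique[OF axis_movable_time_interval[OF assms(1)] assms(2)] assms(3,4)
    unfolding has_vector_derivative_def by blast
  then show ?thesis by (metis scaleR_one)
qed

lemma vector_derivative_eqI:
  assumes "time_interval I" "t \<in> I" "(f has_vector_derivative a) (at t within I)"
  shows "vector_derivative f (at t within I) = (a :: real)"
  using assms vector_derivative_unique_time_interval
  unfolding vector_derivative_def by blast

text \<open>Integrating \<open>f\<^sub>s\<^sub>t\<close> in \<open>s\<close> and differentiating under the integral in \<open>t\<close> gives
  \<open>f\<^sub>t (t, s) - f\<^sub>t (t, a) = \<integral> f\<^sub>s\<^sub>t (t, \<sigma>) d\<sigma>\<close> over \<open>[a, s]\<close>, and this is differentiated in \<open>s\<close>.
  The argument works with derivatives within intervals throughout, and so covers boundary points and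
  corners of the rectangle.\<close>

lemma mixed_partials_commute:
  fixes f :: "real \<Rightarrow> real \<Rightarrow> real"
  assumes I: "time_interval I" and J: "time_interval J" and t0: "t0 \<in> I" and s0: "s0 \<in> J"
    and ft: "\<And>t s. t \<in> I \<Longrightarrow> s \<in> J \<Longrightarrow> ((\<lambda>t. f t s) has_vector_derivative ft t s) (at t within I)"
    and fs: "\<And>t s. t \<in> I \<Longrightarrow> s \<in> J \<Longrightarrow> ((\<lambda>s. f t s) has_vector_derivative fs t s) (at s within J)"
    and dsft: "\<And>t s. t \<in> I \<Longrightarrow> s \<in> J \<Longrightarrow> ((\<lambda>s. ft t s) has_vector_derivative dsft t s) (at s within J)"
    and dtfs: "\<And>t s. t \<in> I \<Longrightarrow> s \<in> J \<Longrightarrow> ((\<lambda>t. fs t s) has_vector_derivative dtfs t s) (at t within I)"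
    and cont: "continuous_on (I \<times> J) (\<lambda>(t, s). dtfs t s)"
  shows "dsft t0 s0 = dtfs t0 s0"
proof -
  obtain x where x: "x \<in> J" "x \<noteq> s0" using time_interval_other_point[OF J] .
  define a b where "a = min x s0" and "b = max x s0"
  have ab: "a < b" "s0 \<in> {a..b}" using x by (auto simp: a_def b_def)
  have "a \<in> J" "b \<in> J" using x s0 by (auto simp: a_def b_def min_def max_def)
  then have sub: "{a..b} \<subseteq> J"
    using J mem_is_interval_1_I[of J a b] unfolding time_interval_def by (metis atLeastAtMost_iff subsetI)
  have conv: "convex I" using I by (simp add: time_interval_def is_interval_convex)
  have ftint: "ft t0 s - ft t0 a = integral {a..s} (dtfs t0)" if s: "s \<in> {a..b}" for s
  proof -
    have subs: "{a..s} \<subseteq> J" using sub s by auto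
    have ftc: "(fs t has_integral f t s - f t a) {a..s}" if "t \<in> I" for t
      using that s subs
      by (intro fundamental_theorem_of_calculus) (auto intro: has_vector_derivative_within_subset[OF fs subs])
    have "((\<lambda>t. integral (cbox a s) (fs t)) has_vector_derivative integral (cbox a s) (dtfs t0)) (at t0 within I)"
    proof (rule leibniz_rule_vector_derivative[OF _ _ _ t0 conv])
      show "((\<lambda>t. fs t \<sigma>) has_vector_derivative dtfs t \<sigma>) (at t within I)"
        if "t \<in> I" "\<sigma> \<in> cbox a s" for t \<sigma>
        using that dtfs subs by auto
      show "fs t integrable_on cbox a s" if "t \<in> I" for t
        using ftc[OF that] by (auto simp: has_integral_integrable)
      show "continuous_on (I \<times> cbox a s) (\<lambda>(t, \<sigma>). dtfs t \<sigma>)"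
        using subs by (auto intro: continuous_on_subset[OF cont])
    qed
    then have "((\<lambda>t. integral {a..s} (fs t)) has_vector_derivative integral {a..s} (dtfs t0)) (at t0 within I)"
      by simp
    then have "((\<lambda>t. f t s - f t a) has_vector_derivative integral {a..s} (dtfs t0)) (at t0 within I)"
      by (rule has_vector_derivative_transform[OF t0, rotated])
        (simp add: integral_unique[OF ftc])
    moreover have "((\<lambda>t. f t s - f t a) has_vector_derivative ft t0 s - ft t0 a) (at t0 within I)"
      using ft t0 s sub \<open>a \<in> J\<close> by (intro derivative_intros) auto
    ultimately show ?thesis using vector_derivative_unique_time_interval[OF I t0] by blast
  qed
  have tab: "time_interval {a..b}" using ab by (auto simp: time_interval_def is_interval_cc)
  have "continuous_on {a..b} (\<lambda>s. (\<lambda>(t, s). dtfs t s) (t0, s))"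
    using t0 sub by (intro continuous_on_compose2[OF cont] continuous_intros) auto
  then have "((\<lambda>s. integral {a..s} (dtfs t0)) has_vector_derivative dtfs t0 s0) (at s0 within {a..b})"
    using ab by (intro integral_has_vector_derivative) auto
  then have "((\<lambda>s. ft t0 s - ft t0 a) has_vector_derivative dtfs t0 s0) (at s0 within {a..b})"
    by (rule has_vector_derivative_transform[OF ab(2), rotated]) (simp add: ftint)
  then have "((\<lambda>s. ft t0 s - ft t0 a + ft t0 a) has_vector_derivative dtfs t0 s0 + 0) (at s0 within {a..b})"
    by (intro derivative_intros)
  moreover have "((\<lambda>s. ft t0 s - ft t0 a + ft t0 a) has_vector_derivative dsft t0 s0) (at s0 within {a..b})"
    using dsft[OF t0 s0] sub by (auto intro: has_vector_derivative_within_subset)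
  ultimately show ?thesis
    using vector_derivative_unique_time_interval[OF tab ab(2)] by fastforce
qed

section \<open>Positivity of the top exterior power\<close>

lemma wedge_power_eq_zero_if_equal:
  fixes v :: "'n::finite \<times> bool \<Rightarrow> complex^'n"
  assumes "x \<noteq> y" "v x = v y"
  shows "wedge_power \<alpha> v = 0"
proof -
  define term' where "term' \<sigma> = of_int (sign \<sigma>) *
      (\<Prod>k\<in>UNIV. \<alpha> (v (\<sigma> (k, False))) (v (\<sigma> (k, True))))" for \<sigma>
  have v: "v (Transposition.transpose x y p) = v p" for p
    using assms by (cases "p = x"; cases "p = y") auto
  have "term' (Transposition.transpose x y \<circ> \<sigma>) = - term' \<sigma>" if "\<sigma> permutes UNIV" for \<sigma>
    using that \<open>x \<noteq> y\<close> permutation_permutes[of \<sigma>]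
    by (auto simp: term'_def v sign_compose sign_swap_id permutation_swap_id)
  then have "sum term' {\<sigma>. \<sigma> permutes UNIV} = (\<Sum>\<sigma> | \<sigma> permutes UNIV. - term' \<sigma>)"
    using setum_permutations_compose_left[of "Transposition.transpose x y" UNIV term']
    by (simp add: permutes_swap_id)
  then have "sum term' {\<sigma>. \<sigma> permutes UNIV} = 0"
    by (simp add: sum_negf)
  then show ?thesis by (simp add: wedge_power_def term'_def)
qed

text \<open>For each permutation exactly one factor of the product contains the vector in question.\<close>

lemma linear_wedge_power_slot:
  fixes v :: "'n::finite \<times> bool \<Rightarrow> complex^'n"
  assumes "bilinear \<alpha>"
  shows "linear (\<lambda>a. wedge_power \<alpha> (v(x := a)))"
proof -
  have "linear (\<lambda>a. \<Prod>k\<in>UNIV. \<alpha> ((v(x := a)) (\<sigma> (k, False))) ((v(x := a)) (\<sigma> (k, True))))"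
    if \<sigma>: "\<sigma> permutes UNIV" for \<sigma>
  proof -
    have inj: "\<sigma> p = \<sigma> q \<longleftrightarrow> p = q" for p q using permutes_inj[OF \<sigma>] by (auto dest: injD)
    obtain k b where kb: "\<sigma> (k, b) = x"
      using permutes_surj[OF \<sigma>] by (metis surjD surj_pair)
    define C where "C = (\<Prod>j\<in>UNIV - {k}. \<alpha> (v (\<sigma> (j, False))) (v (\<sigma> (j, True))))"
    have "(\<Prod>j\<in>UNIV - {k}. \<alpha> ((v(x := a)) (\<sigma> (j, False))) ((v(x := a)) (\<sigma> (j, True)))) = C" for a
      unfolding C_def by (intro prod.cong refl) (auto simp: kb[symmetric] inj)
    then have eq: "(\<lambda>a. \<Prod>j\<in>UNIV. \<alpha> ((v(x := a)) (\<sigma> (j, False))) ((v(x := a)) (\<sigma> (j, True)))) =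
        (\<lambda>a. \<alpha> ((v(x := a)) (\<sigma> (k, False))) ((v(x := a)) (\<sigma> (k, True))) * C)"
      by (subst prod.remove[of UNIV k]) auto
    have "linear (\<lambda>a. \<alpha> ((v(x := a)) (\<sigma> (k, False))) ((v(x := a)) (\<sigma> (k, True))))"
      using assms by (cases b) (auto simp: kb[symmetric] inj bilinear_def)
    then show ?thesis unfolding eq
      by (simp add: linear_iff algebra_simps)
  qed
  note L = this
  have "linear (\<lambda>a. \<Sum>\<sigma> | \<sigma> permutes UNIV. of_int (sign \<sigma>) *
      (\<Prod>k\<in>UNIV. \<alpha> ((v(x := a)) (\<sigma> (k, False))) ((v(x := a)) (\<sigma> (k, True)))))"
    using L by (intro linear_compose_sum) (auto simp: linear_iff algebra_simps)
  then show ?thesis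
    unfolding wedge_power_def by (simp add: linear_iff add_divide_distrib)
qed

lemma wedge_power_add_span:
  fixes v :: "'n::finite \<times> bool \<Rightarrow> complex^'n"
  assumes "bilinear \<alpha>" and w: "w \<in> span (v ` (UNIV - {x}))"
  shows "wedge_power \<alpha> (v(x := v x + w)) = wedge_power \<alpha> v"
proof -
  have lin: "linear (\<lambda>a. wedge_power \<alpha> (v(x := a)))"
    by (rule linear_wedge_power_slot[OF assms(1)])
  have "wedge_power \<alpha> (v(x := a)) = 0" if a: "a \<in> v ` (UNIV - {x})" for a
  proof -
    obtain y where "y \<noteq> x" "a = v y" using a by auto
    then show ?thesis by (intro wedge_power_eq_zero_if_equal[of x y]) auto
  qed
  then have "wedge_power \<alpha> (v(x := w)) = 0"
    using linear_eq_0_on_span[OF lin _ w] by blast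
  then show ?thesis using linear_add[OF lin, of "v x" w] by simp
qed

text \<open>Permuting the pairs moves both entries of each pair in the same way, which is an even
  permutation.\<close>

lemma sign_permute_pairs:
  fixes \<pi> :: "'n::finite \<Rightarrow> 'n"
  assumes "\<pi> permutes UNIV"
  shows "permutation (\<lambda>(k, b::bool). (\<pi> k, b)) \<and> sign (\<lambda>(k, b::bool). (\<pi> k, b)) = 1"
  using assms finite
proof (induction rule: permutes_induct)
  case id
  have "(\<lambda>(k::'n, b::bool). (id k, b)) = id" by auto
  then show ?case by simp
next
  case (swap a b p)
  define q where "q = (\<lambda>(k, c::bool). (p k, c))"
  have q: "permutation q" "sign q = 1" using swap by (simp_all add: q_def)
  have eq: "(\<lambda>(k, c::bool). ((Transposition.transpose a b \<circ> p) k, c)) =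
      Transposition.transpose (a, False) (b, False) \<circ> (Transposition.transpose (a, True) (b, True) \<circ> q)"
    by (auto simp: fun_eq_iff Transposition.transpose_def q_def)
  have p2: "permutation (Transposition.transpose (a, True) (b, True) \<circ> q)"
    by (intro permutation_compose permutation_swap_id q)
  have "permutation (Transposition.transpose (a, False) (b, False) \<circ>
      (Transposition.transpose (a, True) (b, True) \<circ> q))"
    by (intro permutation_compose permutation_swap_id q)
  moreover have "sign (Transposition.transpose (a, False) (b, False) \<circ>
      (Transposition.transpose (a, True) (b, True) \<circ> q)) = 1"
    unfolding sign_compose[OF permutation_swap_id p2] sign_compose[OF permutation_swap_id q(1)]
    using swap(3) q(2) by (simp add: sign_swap_id)
  ultimately show ?case unfolding eq by (rule conjI)
qed

text \<open>A permutation contributes only if it maps pairs to pairs. Exchanging the two entries of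
  a pair changes the sign of the permutation and of one factor, so the contribution is the same
  as without exchanges, where the permutation is even and all factors are positive.\<close>

lemma wedge_power_orthogonal_pairs:
  fixes v :: "'n::finite \<times> bool \<Rightarrow> complex^'n"
  assumes anti: "\<And>u w. \<alpha> u w = - \<alpha> w u"
    and orth: "\<And>j k b c. j \<noteq> k \<Longrightarrow> \<alpha> (v (j, b)) (v (k, c)) = 0"
    and pos: "\<And>k. \<alpha> (v (k, False)) (v (k, True)) > 0"
  shows "wedge_power \<alpha> v > 0"
proof -
  define term' where "term' \<sigma> = of_int (sign \<sigma>) *
      (\<Prod>k\<in>UNIV. \<alpha> (v (\<sigma> (k, False))) (v (\<sigma> (k, True))))" for \<sigma>
  have paired: "term' \<sigma> \<ge> 0"
    if "\<sigma> permutes UNIV" "\<And>k. fst (\<sigma> (k, False)) = fst (\<sigma> (k, True))" for \<sigma>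
    using that
  proof (induction "card {k. snd (\<sigma> (k, False))}" arbitrary: \<sigma>)
    case 0
    have inj: "\<sigma> p = \<sigma> q \<longleftrightarrow> p = q" for p q
      using permutes_inj[OF 0(2)] by (auto dest: injD)
    have F: "\<not> snd (\<sigma> (k, False))" for k using 0(1) by auto
    have T: "snd (\<sigma> (k, True))" for k
      using F[of k] inj[of "(k, True)" "(k, False)"] 0(3)[of k] by (auto simp: prod_eq_iff)
    define \<pi> where "\<pi> k = fst (\<sigma> (k, False))" for k
    have \<sigma>: "\<sigma> (k, b) = (\<pi> k, b)" for k b
      using F T 0(3) by (cases b) (auto simp: \<pi>_def prod_eq_iff)
    have "inj \<pi>" using inj \<sigma> by (intro injI) (metis prod.inject)
    then have "\<pi> permutes UNIV" by (intro bij_imp_permutes) (auto simp: bij_def finite_UNIV_inj_surj)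
    moreover have "\<sigma> = (\<lambda>(k, b). (\<pi> k, b))" by (auto simp: \<sigma>)
    ultimately have "sign \<sigma> = 1" using sign_permute_pairs by blast
    then show ?case by (simp add: term'_def \<sigma> prod_nonneg pos less_imp_le)
  next
    case (Suc m)
    then obtain k where k: "snd (\<sigma> (k, False))"
      by (metis (mono_tags, lifting) card.empty empty_Collect_eq nat.distinct(1))
    define \<tau> where "\<tau> = \<sigma> \<circ> Transposition.transpose (k, False) (k, True)"
    have \<tau>_k: "\<tau> (k, False) = \<sigma> (k, True)" "\<tau> (k, True) = \<sigma> (k, False)"
      by (auto simp: \<tau>_def)
    have \<tau>_other: "\<tau> (j, b) = \<sigma> (j, b)" if "j \<noteq> k" for j b
      using that by (simp add: \<tau>_def Transposition.transpose_def)
    have \<tau>: "\<tau> permutes UNIV"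
      unfolding \<tau>_def by (rule permutes_compose[OF _ Suc.prems(1)]) (simp add: permutes_swap_id)
    have paired_\<tau>: "fst (\<tau> (j, False)) = fst (\<tau> (j, True))" for j
      using Suc.prems(2) by (cases "j = k") (auto simp: \<tau>_k \<tau>_other)
    have "\<sigma> (k, True) \<noteq> \<sigma> (k, False)"
      using permutes_inj[OF Suc.prems(1)] by (auto dest: injD)
    then have "\<not> snd (\<sigma> (k, True))"
      using k Suc.prems(2)[of k] by (auto simp: prod_eq_iff)
    then have "{j. snd (\<tau> (j, False))} = {j. snd (\<sigma> (j, False))} - {k}"
      using \<tau>_k \<tau>_other by auto metis+
    then have "card {j. snd (\<tau> (j, False))} = m"
      using Suc(2) k by (simp add: card_Diff_singleton_if)
    then have "0 \<le> term' \<tau>" using Suc(1)[of \<tau>] \<tau> paired_\<tau> by blast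
    moreover have "sign \<tau> = - sign \<sigma>"
      unfolding \<tau>_def using Suc.prems(1) permutation_permutes[of \<sigma>]
      by (auto simp: sign_compose sign_swap_id permutation_swap_id)
    moreover have "(\<Prod>j\<in>UNIV. \<alpha> (v (\<tau> (j, False))) (v (\<tau> (j, True)))) =
        - (\<Prod>j\<in>UNIV. \<alpha> (v (\<sigma> (j, False))) (v (\<sigma> (j, True))))"
    proof -
      have "(\<Prod>j\<in>UNIV - {k}. \<alpha> (v (\<tau> (j, False))) (v (\<tau> (j, True)))) =
          (\<Prod>j\<in>UNIV - {k}. \<alpha> (v (\<sigma> (j, False))) (v (\<sigma> (j, True))))"
        by (intro prod.cong) (auto simp: \<tau>_other)
      then show ?thesis
        using anti[of "v (\<sigma> (k, True))"] by (simp add: prod.remove[of UNIV k] \<tau>_k)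
    qed
    ultimately show ?case by (simp add: term'_def)
  qed
  have nonneg: "term' \<sigma> \<ge> 0" if "\<sigma> permutes UNIV" for \<sigma>
  proof (cases "\<forall>k. fst (\<sigma> (k, False)) = fst (\<sigma> (k, True))")
    case True
    then show ?thesis using paired that by blast
  next
    case False
    then obtain k where "fst (\<sigma> (k, False)) \<noteq> fst (\<sigma> (k, True))" by blast
    then have "\<alpha> (v (\<sigma> (k, False))) (v (\<sigma> (k, True))) = 0"
      using orth by (metis prod.collapse)
    then have "(\<Prod>k\<in>UNIV. \<alpha> (v (\<sigma> (k, False))) (v (\<sigma> (k, True)))) = 0"
      by (intro prod_zero) auto
    then show ?thesis unfolding term'_def by (simp only:)
  qed
  have "term' id > 0" by (simp add: term'_def prod_pos pos)
  then have "sum term' {\<sigma>. \<sigma> permutes UNIV} > 0"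
    using nonneg by (intro sum_pos2[of _ id]) (auto simp: permutes_id finite_permutations)
  then show ?thesis by (simp add: wedge_power_def term'_def)
qed

lemma vector_smult_complex:
  "c *s (x :: complex^'n) = Re c *\<^sub>R x + Im c *\<^sub>R (\<i> *s x)"
  by (simp add: vec_eq_iff complex_eq_iff)

text \<open>Complex Gram-Schmidt elimination for the Hermitian metric with fundamental form \<open>\<alpha>\<close> turns
  the coordinate frame into an orthogonal one. Each step adds to a frame vector a
  combination of the others and so leaves the value of the exterior power unchanged. Vectors not
  yet treated are unchanged, and the treated ones have no components outside the treated
  coordinates; this keeps the new vector nonzero.\<close>

lemma wedge_power_positive:
  fixes \<alpha> :: "complex^'n::finite \<Rightarrow> complex^'n \<Rightarrow> real"
  assumes bil: "bilinear \<alpha>" and alt: "\<And>v. \<alpha> v v = 0"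
    and inv: "\<And>u v. \<alpha> (\<i> *s u) (\<i> *s v) = \<alpha> u v"
    and pos: "\<And>v. v \<noteq> 0 \<Longrightarrow> \<alpha> v (\<i> *s v) > 0"
  shows "wedge_power \<alpha> (\<lambda>(k, b). axis k (if b then \<i> else 1)) > 0"
proof -
  note simps = bilinear_ladd[OF bil] bilinear_radd[OF bil] bilinear_lmul[OF bil]
    bilinear_rmul[OF bil] bilinear_lneg[OF bil] bilinear_rneg[OF bil]
    bilinear_lsub[OF bil] bilinear_rsub[OF bil] bilinear_lzero[OF bil] bilinear_rzero[OF bil]
  have anti: "\<alpha> u w = - \<alpha> w u" for u w
  proof -
    have "\<alpha> (u + w) (u + w) = \<alpha> u u + \<alpha> u w + \<alpha> w u + \<alpha> w w" by (simp add: simps)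
    then show ?thesis using alt by (metis add.left_neutral add.right_neutral eq_neg_iff_add_eq_0)
  qed
  have ii: "\<i> *s (\<i> *s u) = - u" for u :: "complex^'n"
    by (simp add: vec_eq_iff)
  have swap: "\<alpha> (\<i> *s u) w = - \<alpha> u (\<i> *s w)" for u w
    using inv[of "\<i> *s u" w] by (simp add: ii simps)
  define orth where "orth u w \<longleftrightarrow> \<alpha> u w = 0 \<and> \<alpha> u (\<i> *s w) = 0" for u w
  have orth_sym: "orth w u" if "orth u w" for u w
    using that anti[of w u] anti[of w "\<i> *s u"] swap[of u w] by (auto simp: orth_def)
  have orth_add: "orth (u + u') w" if "orth u w" "orth u' w" for u u' w
    using that by (simp add: orth_def simps)
  have orth_smult: "orth (c *s u) w" if "orth u w" for c u w
    using that by (simp add: orth_def vector_smult_complex[of c] simps swap inv)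
  have orth_sum: "orth (\<Sum>j\<in>S. f j) w" if "\<And>j. j \<in> S \<Longrightarrow> orth (f j) w" "finite S"
    for S :: "'n set" and f w
    using that(2,1)
  proof (induction rule: finite_induct)
    case empty
    show ?case by (simp add: orth_def simps)
  next
    case (insert j S)
    then show ?case by (simp add: orth_add)
  qed
  define frame :: "('n \<Rightarrow> complex^'n) \<Rightarrow> 'n \<times> bool \<Rightarrow> complex^'n"
    where "frame u = (\<lambda>(k, b). (if b then \<i> else 1) *s u k)" for u
  define adapted where "adapted S u \<longleftrightarrow>
      wedge_power \<alpha> (frame u) = wedge_power \<alpha> (frame (\<lambda>k. axis k 1)) \<and>
      (\<forall>l. l \<notin> S \<longrightarrow> u l = axis l 1) \<and>
      (\<forall>j\<in>S. u j \<noteq> 0 \<and> (\<forall>l. l \<notin> S \<longrightarrow> u j $ l = 0)) \<and>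
      (\<forall>j\<in>S. \<forall>l\<in>S. j \<noteq> l \<longrightarrow> orth (u j) (u l))" for S u
  have "\<exists>u. adapted S u" for S
    using finite[of S]
  proof (induction S rule: finite_induct)
    case empty
    show ?case by (intro exI[of _ "\<lambda>k. axis k 1"]) (simp add: adapted_def)
  next
    case (insert k S)
    obtain u where adapted_u: "adapted S u" using insert.IH ..
    then have u: "wedge_power \<alpha> (frame u) = wedge_power \<alpha> (frame (\<lambda>k. axis k 1))"
        "\<And>l. l \<notin> S \<Longrightarrow> u l = axis l 1" "\<And>j. j \<in> S \<Longrightarrow> u j \<noteq> 0"
        "\<And>j l. j \<in> S \<Longrightarrow> l \<notin> S \<Longrightarrow> u j $ l = 0"
        "\<And>j l. j \<in> S \<Longrightarrow> l \<in> S \<Longrightarrow> j \<noteq> l \<Longrightarrow> orth (u j) (u l)"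
      by (simp_all add: adapted_def)
    define N where "N j = \<alpha> (u j) (\<i> *s u j)" for j
    have N: "N j > 0" if "j \<in> S" for j using pos u(3) that by (simp add: N_def)
    \<comment> \<open>minus the coefficient of the orthogonal projection of \<open>u k\<close> to the complex line of \<open>u j\<close>\<close>
    define c where "c j = Complex (- \<alpha> (u k) (\<i> *s u j) / N j) (\<alpha> (u k) (u j) / N j)" for j
    define w where "w = (\<Sum>j\<in>S. c j *s u j)"
    define u' where "u' = u(k := u k + w)"
    have orth_k: "orth (u' k) (u l)" if l: "l \<in> S" for l
    proof -
      have w: "w = c l *s u l + (\<Sum>j\<in>S - {l}. c j *s u j)"
        unfolding w_def using l insert.hyps(1) by (simp add: sum.remove)
      have "orth (\<Sum>j\<in>S - {l}. c j *s u j) (u l)"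
        using u(5) l insert.hyps(1) by (intro orth_sum orth_smult) auto
      moreover have "\<alpha> (c l *s u l) (u l) = - \<alpha> (u k) (u l)"
        using N[OF l] swap[of "u l" "u l"] unfolding vector_smult_complex[of "c l"]
        by (simp add: simps alt c_def N_def[symmetric])
      moreover have "\<alpha> (c l *s u l) (\<i> *s u l) = - \<alpha> (u k) (\<i> *s u l)"
        using N[OF l] unfolding vector_smult_complex[of "c l"]
        by (simp add: simps alt c_def N_def[symmetric])
      ultimately have "orth (u k + c l *s u l) (u l)" "orth (\<Sum>j\<in>S - {l}. c j *s u j) (u l)"
        by (simp_all add: orth_def simps)
      then show ?thesis
        using orth_add by (simp add: u'_def w add.assoc[symmetric])
    qed
    have span: "z *s w \<in> span (frame u ` (S \<times> UNIV))" for z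
    proof -
      have "z' *s u j \<in> span (frame u ` (S \<times> UNIV))" if "j \<in> S" for z' j
      proof -
        have "u j = frame u (j, False)" "\<i> *s u j = frame u (j, True)" by (auto simp: frame_def)
        then have "u j \<in> span (frame u ` (S \<times> UNIV))" "\<i> *s u j \<in> span (frame u ` (S \<times> UNIV))"
          using that by (metis SigmaI UNIV_I imageI span_base)+
        then show ?thesis
          unfolding vector_smult_complex[of z'] by (intro span_add span_scale)
      qed
      moreover have "z *s w = (\<Sum>j\<in>S. (z * c j) *s u j)"
        by (simp add: w_def vec_eq_iff sum_distrib_left mult.assoc)
      ultimately show ?thesis by (simp add: span_sum)
    qed
    define f where "f = (frame u)((k, False) := frame u (k, False) + w)"
    have "wedge_power \<alpha> f = wedge_power \<alpha> (frame u)"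
    proof -
      have "span (frame u ` (S \<times> UNIV)) \<subseteq> span (frame u ` (UNIV - {(k, False)}))"
        using insert.hyps(2) by (intro span_mono) auto
      then show ?thesis
        unfolding f_def using span[of 1] by (intro wedge_power_add_span[OF bil]) auto
    qed
    moreover have "wedge_power \<alpha> (f((k, True) := f (k, True) + \<i> *s w)) = wedge_power \<alpha> f"
    proof -
      have "frame u ` (S \<times> UNIV) \<subseteq> f ` (UNIV - {(k, True)})"
      proof
        fix y assume "y \<in> frame u ` (S \<times> UNIV)"
        then obtain j b where jb: "j \<in> S" "y = frame u (j, b)" by auto
        then have "y = f (j, b)" "(j, b) \<noteq> (k, True)"
          using insert.hyps(2) by (auto simp: f_def)
        then show "y \<in> f ` (UNIV - {(k, True)})" by blast
      qed
      from span_mono[OF this] show ?thesis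
        using span[of \<i>] by (intro wedge_power_add_span[OF bil]) auto
    qed
    moreover have "f((k, True) := f (k, True) + \<i> *s w) = frame u'"
      by (auto simp: f_def u'_def frame_def fun_eq_iff vec_eq_iff algebra_simps)
    ultimately have "wedge_power \<alpha> (frame u') = wedge_power \<alpha> (frame (\<lambda>k. axis k 1))"
      using u(1) by simp
    moreover have "\<forall>l. l \<notin> insert k S \<longrightarrow> u' l = axis l 1" using u(2) by (simp add: u'_def)
    moreover have "u' j \<noteq> 0 \<and> (\<forall>l. l \<notin> insert k S \<longrightarrow> u' j $ l = 0)" if j: "j \<in> insert k S" for j
    proof (cases "j = k")
      case True
      have "w $ l = 0" if "l \<notin> S" for l
        using u(4) that by (simp add: w_def)
      then show ?thesis
        using insert.hyps(2) u(2)[of k] True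
        by (auto simp: u'_def axis_def vec_eq_iff intro!: exI[of _ k])
    next
      case False
      then show ?thesis using j u(3,4) by (auto simp: u'_def)
    qed
    moreover have "\<forall>j\<in>insert k S. \<forall>l\<in>insert k S. j \<noteq> l \<longrightarrow> orth (u' j) (u' l)"
      using orth_k u(5) orth_sym insert.hyps(2) by (auto simp: u'_def)
    ultimately have "adapted (insert k S) u'" by (simp add: adapted_def)
    then show ?case by blast
  qed
  from this[of UNIV] obtain u
    where u: "wedge_power \<alpha> (frame u) = wedge_power \<alpha> (frame (\<lambda>k. axis k 1))"
      "\<And>j. u j \<noteq> 0" "\<And>j l. j \<noteq> l \<Longrightarrow> orth (u j) (u l)"
    by (auto simp: adapted_def)
  have "wedge_power \<alpha> (frame u) > 0"
  proof (rule wedge_power_orthogonal_pairs[OF anti])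
    show "\<alpha> (frame u (j, b)) (frame u (k, c)) = 0" if "j \<noteq> k" for j k b c
      using u(3)[OF that] swap[of "u j"] inv[of "u j"]
      by (cases b; cases c) (auto simp: frame_def orth_def)
    show "\<alpha> (frame u (k, False)) (frame u (k, True)) > 0" for k
      using pos u(2) by (simp add: frame_def)
  qed
  moreover have "frame (\<lambda>k. axis k 1) = (\<lambda>(k, b). axis k (if b then \<i> else 1))"
    by (auto simp: frame_def fun_eq_iff axis_def vec_eq_iff)
  ultimately show ?thesis using u(1) by simp
qed

section \<open>Smooth families of functions on a complex manifold\<close>

lemma smooth_family_cong:
  assumes "\<And>t p. t \<in> S \<Longrightarrow> F t p = G t p" "smooth_family \<A> S F" shows "smooth_family \<A> S G"
  unfolding smooth_family_def
proof
  fix c assume "c \<in> \<A>"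
  then have "smooth_on (S \<times> chart_image c) (\<lambda>(t, z). F t (chart_inv c z))"
    using assms(2) by (simp add: smooth_family_def)
  then show "smooth_on (S \<times> chart_image c) (\<lambda>(t, z). G t (chart_inv c z))"
    by (rule smooth_on_cong[rotated]) (auto simp: assms(1))
qed

lemma smooth_family_add:
  "smooth_family \<A> S F \<Longrightarrow> smooth_family \<A> S G \<Longrightarrow> smooth_family \<A> S (\<lambda>t p. F t p + G t p)"
  using smooth_on_add unfolding smooth_family_def by (fastforce simp: case_prod_beta')

lemma smooth_family_mult:
  "smooth_family \<A> S F \<Longrightarrow> smooth_family \<A> S G \<Longrightarrow> smooth_family \<A> S (\<lambda>t p. F t p * G t p)"
  using smooth_on_mult unfolding smooth_family_def by (fastforce simp: case_prod_beta')

lemma smooth_family_const: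
  assumes "smooth_fun \<A> f" shows "smooth_family \<A> S (\<lambda>_. f)"
  unfolding smooth_family_def
proof
  fix c assume "c \<in> \<A>"
  then have "smooth_on (chart_image c) (f \<circ> chart_inv c)" using assms by (simp add: smooth_fun_def)
  from smooth_on_compose_affine[OF bounded_linear_snd _ this, of "S \<times> chart_image c" 0]
  show "smooth_on (S \<times> chart_image c) (\<lambda>(t, z). f (chart_inv c z))"
    by (auto simp: case_prod_beta')
qed

lemma smooth_family_scalar:
  assumes "smooth_on S h" shows "smooth_family \<A> S (\<lambda>t _. h t)"
  unfolding smooth_family_def
proof
  fix c :: "('b, 'c) chart"
  from smooth_on_compose_affine[OF bounded_linear_fst _ assms, of "S \<times> chart_image c" 0]
  show "smooth_on (S \<times> chart_image c) (\<lambda>(t, z). h t)"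
    by (auto simp: case_prod_beta')
qed

lemma smooth_family_reparametrize:
  assumes L: "bounded_linear L" and sub: "\<And>t. t \<in> T \<Longrightarrow> L t + a \<in> S" and F: "smooth_family \<A> S F"
  shows "smooth_family \<A> T (\<lambda>t. F (L t + a))"
  unfolding smooth_family_def
proof
  fix c assume "c \<in> \<A>"
  then have *: "smooth_on (S \<times> chart_image c) (\<lambda>(t, z). F t (chart_inv c z))"
    using F by (simp add: smooth_family_def)
  have "bounded_linear (\<lambda>x. (L (fst x), snd x))"
    by (intro bounded_linear_Pair bounded_linear_compose[OF L] bounded_linear_fst bounded_linear_snd)
  from smooth_on_compose_affine[OF this _ *, of "T \<times> chart_image c" "(a, 0)"] sub
  show "smooth_on (T \<times> chart_image c) (\<lambda>(t, z). F (L t + a) (chart_inv c z))"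
    by (auto simp: case_prod_beta')
qed

lemma smooth_family_slice:
  assumes "t \<in> S" "smooth_family \<A> S F" shows "smooth_fun \<A> (F t)"
  unfolding smooth_fun_def
proof
  fix c assume "c \<in> \<A>"
  then have *: "smooth_on (S \<times> chart_image c) (\<lambda>(t, z). F t (chart_inv c z))"
    using assms by (simp add: smooth_family_def)
  have "bounded_linear (\<lambda>z. (0, z))"
    by (intro bounded_linear_Pair bounded_linear_zero bounded_linear_ident)
  from smooth_on_compose_affine[OF this _ *, of "chart_image c" "(t, 0)"] assms
  show "smooth_on (chart_image c) (F t \<circ> chart_inv c)"
    by (auto simp: comp_def)
qed

lemma smooth_fun_constant: "smooth_fun \<A> (\<lambda>_. a)"
  by (simp add: smooth_fun_def comp_def smooth_on_const)

lemma smooth_fun_add: "smooth_fun \<A> f \<Longrightarrow> smooth_fun \<A> g \<Longrightarrow> smooth_fun \<A> (\<lambda>p. f p + g p)"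
  using smooth_on_add unfolding smooth_fun_def comp_def by fast

lemma smooth_fun_mult: "smooth_fun \<A> f \<Longrightarrow> smooth_fun \<A> g \<Longrightarrow> smooth_fun \<A> (\<lambda>p. f p * g p)"
  using smooth_on_mult unfolding smooth_fun_def comp_def by fast

lemma smooth_fun_inverse:
  "smooth_fun \<A> f \<Longrightarrow> (\<And>p. f p \<noteq> 0) \<Longrightarrow> smooth_fun \<A> (\<lambda>p. inverse (f p))"
  using smooth_on_inverse unfolding smooth_fun_def comp_def by fast

lemma smooth_fun_cmult: "smooth_fun \<A> f \<Longrightarrow> smooth_fun \<A> (\<lambda>p. a * f p)"
  by (intro smooth_fun_mult smooth_fun_constant)

lemma smooth_fun_diff: "smooth_fun \<A> f \<Longrightarrow> smooth_fun \<A> g \<Longrightarrow> smooth_fun \<A> (\<lambda>p. f p - g p)"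
  using smooth_fun_add[of \<A> f "\<lambda>p. -1 * g p"] smooth_fun_cmult[of \<A> g "-1"] by simp

lemma smooth_family_cmult: "smooth_family \<A> S F \<Longrightarrow> smooth_family \<A> S (\<lambda>t p. a * F t p)"
  by (intro smooth_family_mult smooth_family_const smooth_fun_constant)

lemma smooth_family_diff:
  "smooth_family \<A> S F \<Longrightarrow> smooth_family \<A> S G \<Longrightarrow> smooth_family \<A> S (\<lambda>t p. F t p - G t p)"
  using smooth_family_add[of \<A> S F "\<lambda>t p. -1 * G t p"] smooth_family_cmult[of \<A> S G "-1"] by simp

lemma chart_inv_in: "z \<in> chart_image c \<Longrightarrow> chart_inv c z \<in> fst c"
  by (rule inv_into_into)

lemma chart_chart_inv: "z \<in> chart_image c \<Longrightarrow> snd c (chart_inv c z) = z"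
  by (rule f_inv_into_f)

lemma complex_atlas_chart:
  assumes "complex_atlas \<A>" "c \<in> \<A>"
  shows "open (fst c)" "open (chart_image c)" "continuous_on (fst c) (snd c)"
    "continuous_on (chart_image c) (chart_inv c)" "p \<in> fst c \<Longrightarrow> chart_inv c (snd c p) = p"
  using assms unfolding complex_atlas_def is_chart_def homeomorphism_def by blast+

lemma complex_atlas_cover:
  assumes "complex_atlas \<A>" obtains c where "c \<in> \<A>" "p \<in> fst c"
  using assms unfolding complex_atlas_def by blast

text \<open>Derivatives of a smooth family with respect to the parameters are taken at fixed points of
  the manifold, hence do not depend on the chart in which smoothness is tested.\<close>

lemma smooth_family_derivative:
  assumes at: "complex_atlas \<A>" and mov: "axis_movable S" and F: "smooth_family \<A> S F"
  obtains F' where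
    "\<And>t p. t \<in> S \<Longrightarrow> ((\<lambda>t. F t p) has_derivative (\<lambda>e. F' e t p)) (at t within S)"
    "\<And>e. smooth_family \<A> S (F' e)"
proof -
  define F' where "F' e t p = frechet_derivative (\<lambda>t. F t p) (at t within S) e" for e t p
  have chart: "((\<lambda>t. F t p) has_derivative (\<lambda>e. F' e t p)) (at t within S)
      \<and> (\<forall>e. F' e t p = f' (t, z) (e, 0))"
    if f': "\<And>x. x \<in> S \<times> chart_image c \<Longrightarrow>
        ((\<lambda>(t, z). F t (chart_inv c z)) has_derivative f' x) (at x within S \<times> chart_image c)"
      and z: "z \<in> chart_image c" "p = chart_inv c z" and t: "t \<in> S" for c f' t z p
  proof -
    have "((\<lambda>t. (t, z)) has_derivative (\<lambda>e. (e, 0))) (at t within S)"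
      by (auto intro!: derivative_eq_intros)
    moreover have "((\<lambda>(t, z). F t (chart_inv c z)) has_derivative f' (t, z))
        (at (t, z) within (\<lambda>t. (t, z)) ` S)"
      using f' z(1) t by (intro has_derivative_subset[OF f']) auto
    ultimately have d: "((\<lambda>t. F t p) has_derivative (\<lambda>e. f' (t, z) (e, 0))) (at t within S)"
      unfolding z(2) by (auto dest: has_derivative_in_compose)
    then have d2: "((\<lambda>t. F t p) has_derivative (\<lambda>e. F' e t p)) (at t within S)"
      unfolding F'_def using frechet_derivative_works differentiable_def by blast
    show ?thesis
      using d2 axis_movable_derivative_unique[OF mov t d2 d] by metis
  qed
  have der: "\<exists>f'. (\<forall>x\<in>S \<times> chart_image c.
        ((\<lambda>(t, z). F t (chart_inv c z)) has_derivative f' x) (at x within S \<times> chart_image c)) \<and>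
      (\<forall>v. smooth_on (S \<times> chart_image c) (\<lambda>x. f' x v))" if "c \<in> \<A>" for c
  proof -
    have mov': "axis_movable (S \<times> chart_image c)"
      using axis_movable_Times[OF mov axis_movable_open] complex_atlas_chart(2)[OF at that] .
    have "smooth_on (S \<times> chart_image c) (\<lambda>(t, z). F t (chart_inv c z))"
      using F that by (simp add: smooth_family_def)
    from smooth_on_derivative[OF mov' this] show ?thesis by metis
  qed
  have "((\<lambda>t. F t p) has_derivative (\<lambda>e. F' e t p)) (at t within S)" if "t \<in> S" for t p
  proof -
    obtain c where c: "c \<in> \<A>" "p \<in> fst c" using complex_atlas_cover[OF at] .
    then have "snd c p \<in> chart_image c" "p = chart_inv c (snd c p)"
      using complex_atlas_chart[OF at] by auto
    moreover obtain f' where "\<And>x. x \<in> S \<times> chart_image c \<Longrightarrow>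
        ((\<lambda>(t, z). F t (chart_inv c z)) has_derivative f' x) (at x within S \<times> chart_image c)"
      using der[OF c(1)] by blast
    ultimately show ?thesis using chart[OF _ _ _ that, of c f' "snd c p" p] by blast
  qed
  moreover have "smooth_family \<A> S (F' e)" for e
    unfolding smooth_family_def
  proof
    fix c assume "c \<in> \<A>"
    then obtain f' where f': "\<And>x. x \<in> S \<times> chart_image c \<Longrightarrow>
        ((\<lambda>(t, z). F t (chart_inv c z)) has_derivative f' x) (at x within S \<times> chart_image c)"
      "\<And>v. smooth_on (S \<times> chart_image c) (\<lambda>x. f' x v)"
      using der[of c] by blast
    show "smooth_on (S \<times> chart_image c) (\<lambda>(t, z). F' e t (chart_inv c z))"
    proof (rule smooth_on_cong[OF _ f'(2)[of "(e, 0)"]])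
      fix x assume "x \<in> S \<times> chart_image c"
      then show "f' x (e, 0) = (case x of (t, z) \<Rightarrow> F' e t (chart_inv c z))"
        using chart[OF f'(1), of "snd x" "chart_inv c (snd x)" "fst x"] by auto
    qed
  qed
  ultimately show thesis by (rule that)
qed

lemma velocity_eqI:
  assumes "time_interval I" "t \<in> I" "((\<lambda>t. F t p) has_vector_derivative a) (at t within I)"
  shows "velocity I F t p = a"
  using assms by (simp add: velocity_def vector_derivative_eqI)

lemma has_velocity:
  assumes at: "complex_atlas \<A>" and I: "time_interval I" and F: "smooth_family \<A> I F"
  shows "t \<in> I \<Longrightarrow> ((\<lambda>t. F t p) has_vector_derivative velocity I F t p) (at t within I)"
    and "smooth_family \<A> I (velocity I F)"
proof -
  obtain F' where F': "\<And>t p. t \<in> I \<Longrightarrow> ((\<lambda>t. F t p) has_derivative (\<lambda>e. F' e t p)) (at t within I)"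
      "\<And>e. smooth_family \<A> I (F' e)"
    using smooth_family_derivative[OF at axis_movable_time_interval[OF I] F] by blast
  have der: "((\<lambda>t. F t p) has_vector_derivative F' 1 t p) (at t within I)" if "t \<in> I" for t p
  proof -
    have "linear (\<lambda>e. F' e t p)" using F'(1)[OF that] by (rule has_derivative_linear)
    then have "F' e t p = e *\<^sub>R F' 1 t p" for e using linear_cmul[of "\<lambda>e. F' e t p" e 1] by simp
    then have "(\<lambda>e. F' e t p) = (\<lambda>e. e *\<^sub>R F' 1 t p)" by blast
    then show ?thesis using F'(1)[OF that, of p] by (simp add: has_vector_derivative_def)
  qed
  have vel: "velocity I F t p = F' 1 t p" if "t \<in> I" for t p
    by (rule velocity_eqI[OF I that der[OF that]])
  show "t \<in> I \<Longrightarrow> ((\<lambda>t. F t p) has_vector_derivative velocity I F t p) (at t within I)"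
    using der vel by simp
  show "smooth_family \<A> I (velocity I F)"
    using vel by (intro smooth_family_cong[OF _ F'(2)[of 1]]) auto
qed

lemma smooth_family_slices:
  assumes "smooth_family \<A> (I \<times> J) (\<lambda>(t, s). F t s)"
  shows "t \<in> I \<Longrightarrow> smooth_family \<A> J (F t)" "s \<in> J \<Longrightarrow> smooth_family \<A> I (\<lambda>t. F t s)"
proof -
  have "bounded_linear (\<lambda>s. (0, s))"
    by (intro bounded_linear_Pair bounded_linear_zero bounded_linear_ident)
  from smooth_family_reparametrize[OF this _ assms, of J "(t, 0)"]
  show "t \<in> I \<Longrightarrow> smooth_family \<A> J (F t)" by simp
  have "bounded_linear (\<lambda>t. (t, 0))"
    by (intro bounded_linear_Pair bounded_linear_zero bounded_linear_ident)
  from smooth_family_reparametrize[OF this _ assms, of I "(0, s)"]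
  show "s \<in> J \<Longrightarrow> smooth_family \<A> I (\<lambda>t. F t s)" by simp
qed

lemma smooth_family_swap:
  assumes "smooth_family \<A> (I \<times> J) (\<lambda>(t, s). F t s)"
  shows "smooth_family \<A> (J \<times> I) (\<lambda>(s, t). F t s)"
proof -
  have "bounded_linear (\<lambda>x. (snd x, fst x))"
    by (intro bounded_linear_Pair bounded_linear_fst bounded_linear_snd)
  from smooth_family_reparametrize[OF this _ assms, of "J \<times> I" 0]
  show ?thesis by (auto simp: case_prod_beta')
qed

lemma smooth_family_partial_velocity:
  assumes at: "complex_atlas \<A>" and I: "time_interval I" and J: "time_interval J"
    and F: "smooth_family \<A> (I \<times> J) (\<lambda>(t, s). F t s)"
  shows "smooth_family \<A> (I \<times> J) (\<lambda>(t, s). velocity J (F t) s)"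
proof -
  have "axis_movable (I \<times> J)"
    by (intro axis_movable_Times axis_movable_time_interval I J)
  then obtain F' where F': "\<And>x p. x \<in> I \<times> J \<Longrightarrow>
        ((\<lambda>x. (case x of (t, s) \<Rightarrow> F t s) p) has_derivative (\<lambda>e. F' e x p)) (at x within I \<times> J)"
      "\<And>e. smooth_family \<A> (I \<times> J) (F' e)"
    using smooth_family_derivative[OF at _ F] by blast
  have "velocity J (F t) s p = F' (0, 1) (t, s) p" if ts: "t \<in> I" "s \<in> J" for t s p
  proof (rule velocity_eqI[OF J ts(2)])
    have lin: "linear (\<lambda>e. F' e (t, s) p)"
      using ts by (intro has_derivative_linear[OF F'(1)]) auto
    have "F' (0, e) (t, s) p = e *\<^sub>R F' (0, 1) (t, s) p" for e
      using linear_cmul[OF lin, of e "(0, 1)"] by simp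
    then have eq: "(\<lambda>e. F' (0, e) (t, s) p) = (\<lambda>e. e *\<^sub>R F' (0, 1) (t, s) p)" by blast
    have "((\<lambda>s. (t, s)) has_derivative (\<lambda>e. (0, e))) (at s within J)"
      by (auto intro!: derivative_eq_intros)
    moreover have "((\<lambda>x. (case x of (t, s) \<Rightarrow> F t s) p) has_derivative (\<lambda>e. F' e (t, s) p))
        (at (t, s) within (\<lambda>s. (t, s)) ` J)"
      using ts by (intro has_derivative_subset[OF F'(1)]) auto
    ultimately have "((\<lambda>s. F t s p) has_derivative (\<lambda>e. F' (0, e) (t, s) p)) (at s within J)"
      by (auto dest: has_derivative_in_compose)
    then show "((\<lambda>s. F t s p) has_vector_derivative F' (0, 1) (t, s) p) (at s within J)"
      by (simp add: has_vector_derivative_def eq)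
  qed
  then show ?thesis by (intro smooth_family_cong[OF _ F'(2)[of "(0, 1)"]]) auto
qed

lemma smooth_family_partial_velocity':
  assumes at: "complex_atlas \<A>" and I: "time_interval I" and J: "time_interval J"
    and F: "smooth_family \<A> (I \<times> J) (\<lambda>(t, s). F t s)"
  shows "smooth_family \<A> (I \<times> J) (\<lambda>(t, s). velocity I (\<lambda>t. F t s) t)"
proof -
  have "smooth_family \<A> (J \<times> I) (\<lambda>(s, t). velocity I (\<lambda>t. F t s) t)"
    by (rule smooth_family_partial_velocity[OF at J I smooth_family_swap[OF F]])
  then show ?thesis by (rule smooth_family_swap)
qed

lemma smooth_family_continuous_parameter:
  assumes at: "complex_atlas \<A>" and F: "smooth_family \<A> S F"
  shows "continuous_on S (\<lambda>t. F t p)"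
proof -
  obtain c where c: "c \<in> \<A>" "p \<in> fst c" using complex_atlas_cover[OF at] .
  then have "smooth_on (S \<times> chart_image c) (\<lambda>(t, z). F t (chart_inv c z))"
    using F by (simp add: smooth_family_def)
  then have cont: "continuous_on (S \<times> chart_image c) (\<lambda>(t, z). F t (chart_inv c z))"
    by (rule smooth_on_imp_continuous_on)
  have "continuous_on S (\<lambda>t. (t, snd c p))" by (intro continuous_intros)
  from continuous_on_compose2[OF cont this] have "continuous_on S (\<lambda>t. F t (chart_inv c (snd c p)))"
    using c(2) by (simp add: image_subset_iff)
  then show ?thesis using complex_atlas_chart(5)[OF at c] by simp
qed

lemma velocity_commute:
  assumes at: "complex_atlas \<A>" and I: "time_interval I" and J: "time_interval J"
    and F: "smooth_family \<A> (I \<times> J) (\<lambda>(t, s). F t s)" and t: "t \<in> I" and s: "s \<in> J"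
  shows "velocity I (\<lambda>t. velocity J (F t) s) t p = velocity J (\<lambda>s. velocity I (\<lambda>t. F t s) t) s p"
proof (rule sym, rule mixed_partials_commute[OF I J t s, where f = "\<lambda>t s. F t s p"
      and ft = "\<lambda>t s. velocity I (\<lambda>t. F t s) t p" and fs = "\<lambda>t s. velocity J (F t) s p"
      and dsft = "\<lambda>t s. velocity J (\<lambda>s. velocity I (\<lambda>t. F t s) t) s p"
      and dtfs = "\<lambda>t s. velocity I (\<lambda>t. velocity J (F t) s) t p"])
  note FJ = smooth_family_partial_velocity[OF at I J F]
  note FI = smooth_family_partial_velocity'[OF at I J F]
  fix t s assume ts: "t \<in> I" "s \<in> J"
  show "((\<lambda>t. F t s p) has_vector_derivative velocity I (\<lambda>t. F t s) t p) (at t within I)"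
    by (rule has_velocity(1)[OF at I smooth_family_slices(2)[OF F ts(2)] ts(1)])
  show "((\<lambda>s. F t s p) has_vector_derivative velocity J (F t) s p) (at s within J)"
    by (rule has_velocity(1)[OF at J smooth_family_slices(1)[OF F ts(1)] ts(2)])
  show "((\<lambda>s. velocity I (\<lambda>t. F t s) t p) has_vector_derivative
      velocity J (\<lambda>s. velocity I (\<lambda>t. F t s) t) s p) (at s within J)"
    by (rule has_velocity(1)[OF at J smooth_family_slices(1)[OF FI ts(1)] ts(2)])
  show "((\<lambda>t. velocity J (F t) s p) has_vector_derivative
      velocity I (\<lambda>t. velocity J (F t) s) t p) (at t within I)"
    by (rule has_velocity(1)[OF at I smooth_family_slices(2)[OF FJ ts(2)] ts(1)])
next
  have "smooth_family \<A> (I \<times> J) (\<lambda>(t, s). velocity I (\<lambda>t. velocity J (F t) s) t)"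
    by (rule smooth_family_partial_velocity'[OF at I J smooth_family_partial_velocity[OF at I J F]])
  from smooth_family_continuous_parameter[OF at this, of p]
  show "continuous_on (I \<times> J) (\<lambda>(t, s). velocity I (\<lambda>t. velocity J (F t) s) t p)"
    by (simp add: case_prod_beta')
qed

section \<open>Integration over a compact Kaehler manifold\<close>

text \<open>Tents around points in charts provide a partition of unity: finitely many of them have no
  common zero, and the normalised tents are grouped by chart.\<close>

lemma partition_of_unity_exists:
  fixes \<A> :: "('a::t2_space, 'n::finite) chart set"
  assumes compact: "compact (UNIV :: 'a set)" and at: "complex_atlas \<A>"
  shows "\<exists>B \<rho>. partition_of_unity \<A> B \<rho>"
proof -
  have "\<exists>c K f. c \<in> \<A> \<and> closed K \<and> K \<subseteq> fst c \<and> continuous_on UNIV f \<and> (\<forall>q. 0 \<le> f q) \<and>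
      f p > 0 \<and> {q. f q \<noteq> (0::real)} \<subseteq> K" for p
  proof -
    obtain c where c: "c \<in> \<A>" "p \<in> fst c" using complex_atlas_cover[OF at] .
    note chart = complex_atlas_chart[OF at c(1)]
    have "snd c p \<in> chart_image c" using c(2) by blast
    then obtain r where r: "r > 0" "cball (snd c p) r \<subseteq> chart_image c"
      using chart(2) open_contains_cball by blast
    define K where "K = chart_inv c ` cball (snd c p) r"
    have K: "closed K"
      unfolding K_def
      by (intro compact_imp_closed compact_continuous_image compact_cball
          continuous_on_subset[OF chart(4) r(2)])
    have K_sub: "K \<subseteq> fst c" 
      unfolding K_def by (rule image_subsetI) (rule chart_inv_in[OF subsetD[OF r(2)]])
    define f where "f q = (if q \<in> fst c then max 0 (r - dist (snd c q) (snd c p)) else 0)" for q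
    have supp: "{q. f q \<noteq> 0} \<subseteq> K"
    proof
      fix q assume "q \<in> {q. f q \<noteq> 0}"
      then have q: "q \<in> fst c" "snd c q \<in> cball (snd c p) r"
        by (auto simp: f_def dist_commute split: if_splits)
      then have "q = chart_inv c (snd c q)" using chart(5) by simp
      then show "q \<in> K" using q(2) unfolding K_def by blast
    qed
    have "continuous_on (fst c) (\<lambda>q. max 0 (r - dist (snd c q) (snd c p)))"
      using chart(3) by (intro continuous_intros)
    then have "continuous_on (fst c) f"
      by (rule continuous_on_eq) (simp add: f_def)
    moreover have "continuous_on (- K) f"
      by (rule continuous_on_eq[OF continuous_on_const[of _ 0]]) (use supp in auto)
    ultimately have "continuous_on (fst c \<union> - K) f"
      using chart(1) K by (intro continuous_on_open_Un) auto
    moreover have "fst c \<union> - K = UNIV" using K_sub by blast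
    moreover have "f p > 0" "\<forall>q. 0 \<le> f q" using c(2) r(1) by (auto simp: f_def)
    ultimately show ?thesis using c(1) K K_sub supp by metis
  qed
  then obtain c K f where ckf: "\<And>p. c p \<in> \<A>" "\<And>p. closed (K p)" "\<And>p. K p \<subseteq> fst (c p)"
      "\<And>p. continuous_on UNIV (f p)" "\<And>p q. 0 \<le> f p q" "\<And>p. f p p > 0"
      "\<And>p. {q. f p q \<noteq> (0::real)} \<subseteq> K p"
    by metis
  have "open {q. f p q > 0}" for p
    using open_Collect_less[OF continuous_on_const ckf(4)] by simp
  moreover have "UNIV \<subseteq> (\<Union>p\<in>UNIV. {q. f p q > 0})" using ckf(6) by auto
  ultimately obtain P where P: "finite P" "UNIV \<subseteq> (\<Union>p\<in>P. {q. f p q > 0})"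
    using compactE_image[OF compact, of UNIV "\<lambda>p. {q. f p q > 0}"] by metis
  define total where "total q = (\<Sum>p\<in>P. f p q)" for q
  have total_pos: "total q > 0" for q
  proof -
    obtain p where "p \<in> P" "f p q > 0" using P(2) by auto
    then show ?thesis unfolding total_def using P(1) ckf(5) by (intro sum_pos2[of _ p]) auto
  qed
  define \<rho> where "\<rho> d q = (\<Sum>p\<in>{p\<in>P. c p = d}. f p q) / total q" for d q
  have "continuous_on UNIV (\<rho> d)" for d
    unfolding \<rho>_def using total_pos unfolding total_def
    by (intro continuous_intros ckf(4)) (metis less_irrefl)
  moreover have "0 \<le> \<rho> d q" for d q
    unfolding \<rho>_def using ckf(5) total_pos[of q] by (intro divide_nonneg_pos sum_nonneg) auto
  moreover have "closure {q. \<rho> d q \<noteq> 0} \<subseteq> fst d" for d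
  proof -
    have "{q. \<rho> d q \<noteq> 0} \<subseteq> (\<Union>p\<in>{p\<in>P. c p = d}. K p)"
    proof
      fix q assume "q \<in> {q. \<rho> d q \<noteq> 0}"
      then obtain p where "p \<in> {p\<in>P. c p = d}" "f p q \<noteq> 0"
        unfolding \<rho>_def by (smt (verit) div_0 mem_Collect_eq sum.neutral)
      then show "q \<in> (\<Union>p\<in>{p\<in>P. c p = d}. K p)" using ckf(7) by blast
    qed
    moreover have "closed (\<Union>p\<in>{p\<in>P. c p = d}. K p)"
      using P(1) ckf(2) by (intro closed_UN) auto
    ultimately have "closure {q. \<rho> d q \<noteq> 0} \<subseteq> (\<Union>p\<in>{p\<in>P. c p = d}. K p)"
      by (rule closure_minimal)
    also have "\<dots> \<subseteq> fst d" using ckf(3) by blast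
    finally show ?thesis .
  qed
  moreover have "(\<Sum>d\<in>c ` P. \<rho> d q) = 1" for q
    using total_pos[of q] sum.image_gen[OF P(1), of "\<lambda>p. f p q" c]
    by (simp add: \<rho>_def total_def sum_divide_distrib[symmetric])
  ultimately have "partition_of_unity \<A> (c ` P) \<rho>"
    unfolding partition_of_unity_def using P(1) ckf(1) by auto
  then show ?thesis by blast
qed

locale compact_kaehler =
  fixes \<A> :: "('a::t2_space, 'n::finite) chart set" and \<omega> :: "('a, 'n) two_form"
  assumes compact: "compact (UNIV :: 'a set)" and kaehler: "kaehler_manifold \<A> \<omega>"
begin

lemma atlas: "complex_atlas \<A>"
  using kaehler by (simp add: kaehler_manifold_def)

lemmas chart = complex_atlas_chart[OF atlas]

lemma omega_power_positive:
  assumes "c \<in> \<A>" "z \<in> chart_image c" shows "omega_power \<omega> c z > 0"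
  using kaehler assms unfolding omega_power_def kaehler_manifold_def smooth_two_form_def
    positive_one_one_form_def
  by (intro wedge_power_positive) blast+

lemma omega_power_continuous:
  assumes "c \<in> \<A>" shows "continuous_on (chart_image c) (omega_power \<omega> c)"
proof -
  have "continuous_on (chart_image c) (\<lambda>z. \<omega> c z u v)" for u v
    using kaehler assms unfolding kaehler_manifold_def smooth_two_form_def
    by (intro smooth_on_imp_continuous_on) blast
  then show ?thesis
    unfolding omega_power_def wedge_power_def by (intro continuous_intros) auto
qed

abbreviation I\<omega> :: "('a \<Rightarrow> real) \<Rightarrow> real" where
  "I\<omega> \<equiv> integral_omega_power \<A> \<omega>"

definition pou :: "('a, 'n) chart set \<times> (('a, 'n) chart \<Rightarrow> 'a \<Rightarrow> real)" where
  "pou = (SOME (B, r). partition_of_unity \<A> B r)"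

definition charts :: "('a, 'n) chart set" where "charts = fst pou"

definition weight :: "('a, 'n) chart \<Rightarrow> 'a \<Rightarrow> real" where "weight = snd pou"

lemma pou: "partition_of_unity \<A> charts weight"
proof -
  obtain B \<sigma> where "partition_of_unity \<A> B \<sigma>"
    using partition_of_unity_exists[OF compact atlas] by blast
  then have "\<exists>x. case x of (B, r) \<Rightarrow> partition_of_unity \<A> B r" by auto
  from someI_ex[OF this] have "case pou of (B, r) \<Rightarrow> partition_of_unity \<A> B r"
    unfolding pou_def .
  then show ?thesis by (simp add: charts_def weight_def split_beta)
qed

lemma
  shows finite_charts: "finite charts" and charts_sub: "c \<in> charts \<Longrightarrow> c \<in> \<A>"
    and weight_continuous: "c \<in> charts \<Longrightarrow> continuous_on UNIV (weight c)"
    and weight_nonneg: "c \<in> charts \<Longrightarrow> 0 \<le> weight c p"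
    and weight_support: "c \<in> charts \<Longrightarrow> closure {p. weight c p \<noteq> 0} \<subseteq> fst c"
    and weight_sum: "(\<Sum>c\<in>charts. weight c p) = 1"
  using pou unfolding partition_of_unity_def by blast+

text \<open>Extended by zero, an integrand is continuous on the whole coordinate space with support in a
  fixed box. So the integral is a finite sum of integrals of continuous functions over boxes.\<close>

definition integrand :: "('a, 'n) chart \<Rightarrow> ('a \<Rightarrow> real) \<Rightarrow> complex^'n \<Rightarrow> real" where
  "integrand c f z =
     (if z \<in> chart_image c
      then weight c (chart_inv c z) * f (chart_inv c z) * omega_power \<omega> c z else 0)"

definition support :: "('a, 'n) chart \<Rightarrow> (complex^'n) set" where
  "support c = snd c ` closure {p. weight c p \<noteq> 0}"

definition corner :: "('a, 'n) chart \<Rightarrow> complex^'n" where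
  "corner c = (SOME a. support c \<subseteq> box (-a) a)"

lemma support:
  assumes "c \<in> charts"
  shows "compact (support c)" "support c \<subseteq> chart_image c" "support c \<subseteq> box (- corner c) (corner c)"
    and "z \<notin> support c \<Longrightarrow> integrand c f z = 0"
proof -
  note sub = weight_support[OF assms]
  have "compact (closure {p. weight c p \<noteq> 0})" using compact_Int_closed[OF compact] by force
  then show cpt: "compact (support c)"
    unfolding support_def using chart(3)[OF charts_sub[OF assms]] sub
    by (intro compact_continuous_image) (auto intro: continuous_on_subset)
  show "support c \<subseteq> chart_image c" unfolding support_def using sub by blast
  have "\<exists>a. support c \<subseteq> box (-a) a"
    using bounded_subset_box_symmetric[OF compact_imp_bounded[OF cpt]] by blast
  then show "support c \<subseteq> box (- corner c) (corner c)" unfolding corner_def by (rule someI_ex)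
  show "integrand c f z = 0" if "z \<notin> support c"
  proof (rule ccontr)
    assume "integrand c f z \<noteq> 0"
    then have z: "z \<in> chart_image c" "weight c (chart_inv c z) \<noteq> 0"
      by (auto simp: integrand_def split: if_splits)
    then have "chart_inv c z \<in> closure {p. weight c p \<noteq> 0}"
      by (intro subsetD[OF closure_subset]) simp
    then have "snd c (chart_inv c z) \<in> support c" unfolding support_def by blast
    then show False using that chart_chart_inv[OF z(1)] by simp
  qed
qed

lemma integrand_continuous:
  assumes c: "c \<in> charts" and F: "smooth_family \<A> S F"
  shows "continuous_on (S \<times> UNIV) (\<lambda>(t, z). integrand c (F t) z)"
proof -
  note chart_c = chart[OF charts_sub[OF c]]
  let ?U = "chart_image c" and ?f = "\<lambda>(t, z). integrand c (F t) z"
  have "continuous_on (S \<times> ?U) (\<lambda>(t, z). F t (chart_inv c z))"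
    using F charts_sub[OF c] unfolding smooth_family_def
    by (intro smooth_on_imp_continuous_on) blast
  moreover have inv: "continuous_on (S \<times> ?U) (\<lambda>x. chart_inv c (snd x))"
    by (intro continuous_on_compose2[OF chart_c(4)] continuous_intros) auto
  moreover have "continuous_on (S \<times> ?U) (\<lambda>x. weight c (chart_inv c (snd x)))"
    by (intro continuous_on_compose2[OF weight_continuous[OF c] inv]) auto
  moreover have "continuous_on (S \<times> ?U) (\<lambda>x. omega_power \<omega> c (snd x))"
    by (intro continuous_on_compose2[OF omega_power_continuous[OF charts_sub[OF c]]] continuous_intros)
      auto
  ultimately have "continuous_on (S \<times> ?U) (\<lambda>x. weight c (chart_inv c (snd x)) *
      (case x of (t, z) \<Rightarrow> F t (chart_inv c z)) * omega_power \<omega> c (snd x))"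
    by (intro continuous_intros)
  then have 1: "continuous_on (S \<times> ?U) ?f"
    by (rule continuous_on_eq) (auto simp: integrand_def)
  have 2: "continuous_on (S \<times> - support c) ?f"
    by (rule continuous_on_eq[OF continuous_on_const[of _ 0]]) (auto simp: support(4)[OF c])
  have "closed (support c)" using support(1)[OF c] by (rule compact_imp_closed)
  moreover have "S \<times> UNIV = S \<times> ?U \<union> S \<times> - support c"
    using support(2)[OF c] by blast
  moreover have "openin (top_of_set (S \<times> UNIV)) (S \<times> V)" if "open V" for V :: "(complex^'n) set"
    using that by (intro openin_Times) auto
  ultimately show ?thesis
    using continuous_on_Un_local_open[OF _ _ 1 2] chart_c(2) by (metis open_Compl)
qed

lemma integrand_fun_continuous:
  assumes "c \<in> charts" "smooth_fun \<A> f" shows "continuous_on S (integrand c f)"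
proof -
  have "continuous_on (UNIV \<times> UNIV) (\<lambda>(t::real, z). integrand c f z)"
    using integrand_continuous[OF assms(1) smooth_family_const[OF assms(2)]] .
  moreover have "continuous_on S (\<lambda>z. (0::real, z))" by (intro continuous_intros)
  ultimately show ?thesis using continuous_on_compose2[of "UNIV \<times> UNIV" _ S "\<lambda>z. (0::real, z)"] by fastforce
qed

lemma integral_omega_power_boxes:
  assumes "smooth_fun \<A> f"
  shows "I\<omega> f = (\<Sum>c\<in>charts. integral (cbox (- corner c) (corner c)) (integrand c f))"
proof -
  have "(LINT z:chart_image c|lborel. weight c (chart_inv c z) * f (chart_inv c z) * omega_power \<omega> c z) =
      integral (cbox (- corner c) (corner c)) (integrand c f)" if c: "c \<in> charts" for c
  proof -
    let ?C = "cbox (- corner c) (corner c)"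
    have sub: "support c \<subseteq> ?C" using support(3)[OF c] box_subset_cbox by blast
    have "set_integrable lborel ?C (integrand c f)"
      unfolding set_integrable_def
      by (intro borel_integrable_compact integrand_fun_continuous c assms compact_cbox)
    then have "(LINT z:?C|lborel. integrand c f z) = integral ?C (integrand c f)"
      by (rule set_borel_integral_eq_integral(2))
    moreover have "(LINT z:?C|lborel. integrand c f z) =
        (LINT z:chart_image c|lborel. weight c (chart_inv c z) * f (chart_inv c z) * omega_power \<omega> c z)"
      unfolding set_lebesgue_integral_def
    proof (rule Bochner_Integration.integral_cong[OF refl])
      fix z
      show "indicator ?C z *\<^sub>R integrand c f z = indicator (chart_image c) z *\<^sub>R
          (weight c (chart_inv c z) * f (chart_inv c z) * omega_power \<omega> c z)"
      proof (cases "z \<in> support c")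
        case True
        then show ?thesis using sub support(2)[OF c] by (auto simp: integrand_def indicator_def)
      next
        case False
        then show ?thesis
          using support(4)[OF c False, of f] by (auto simp: integrand_def indicator_def split: if_splits)
      qed
    qed
    ultimately show ?thesis by simp
  qed
  then have "(\<Sum>c\<in>charts. LINT z:chart_image c|lborel.
        weight c (chart_inv c z) * f (chart_inv c z) * omega_power \<omega> c z) =
      (\<Sum>c\<in>charts. integral (cbox (- corner c) (corner c)) (integrand c f))"
    by (intro sum.cong refl)
  then show ?thesis
    by (simp add: integral_omega_power_def Let_def split_beta pou_def[symmetric] charts_def weight_def)
qed

lemma integrand_integrable:
  "c \<in> charts \<Longrightarrow> smooth_fun \<A> f \<Longrightarrow> integrand c f integrable_on cbox a b"
  by (intro integrable_continuous integrand_fun_continuous)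

lemma integral_add:
  assumes "smooth_fun \<A> f" "smooth_fun \<A> g"
  shows "I\<omega> (\<lambda>p. f p + g p) = I\<omega> f + I\<omega> g"
proof -
  have "integrand c (\<lambda>p. f p + g p) = (\<lambda>z. integrand c f z + integrand c g z)" for c
    by (auto simp: integrand_def algebra_simps)
  then show ?thesis using assms
    by (simp add: integral_omega_power_boxes smooth_fun_add integrand_integrable
        Henstock_Kurzweil_Integration.integral_add sum.distrib)
qed

lemma integral_cmult:
  assumes "smooth_fun \<A> f" shows "I\<omega> (\<lambda>p. a * f p) = a * I\<omega> f"
proof -
  have "integrand c (\<lambda>p. a * f p) = (\<lambda>z. a * integrand c f z)" for c
    by (auto simp: integrand_def algebra_simps)
  then show ?thesis using assms
    by (simp add: integral_omega_power_boxes smooth_fun_cmult sum_distrib_left)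
qed

lemma integral_diff:
  assumes "smooth_fun \<A> f" "smooth_fun \<A> g"
  shows "I\<omega> (\<lambda>p. f p - g p) = I\<omega> f - I\<omega> g"
  using integral_add[OF assms(1) smooth_fun_cmult[OF assms(2), of "-1"]]
    integral_cmult[OF assms(2), of "-1"] by simp

text \<open>Some weight of the partition is positive at \<open>p\<close>, and there the integrand has the sign of
  \<open>f p\<close> because \<open>\<omega>\<^sup>n\<close> is positive.\<close>

lemma integral_definite:
  assumes f: "smooth_fun \<A> f" and nonneg: "\<And>p. f p \<ge> 0" and zero: "I\<omega> f = 0"
  shows "f p = 0"
proof (rule ccontr)
  assume "f p \<noteq> 0"
  have nn: "integrand c f z \<ge> 0" if "c \<in> charts" for c z
    using weight_nonneg[OF that] nonneg omega_power_positive[OF charts_sub[OF that]]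
    by (auto simp: integrand_def less_imp_le)
  have "integral (cbox (- corner c) (corner c)) (integrand c f) = 0" if "c \<in> charts" for c
    using zero nn that finite_charts
      Henstock_Kurzweil_Integration.integral_nonneg[OF integrand_integrable[OF _ f]]
    by (simp add: integral_omega_power_boxes[OF f] sum_nonneg_eq_0_iff)
  moreover have "\<exists>c\<in>charts. weight c p \<noteq> 0"
    using weight_sum[of p] by (metis sum.neutral zero_neq_one)
  ultimately obtain c where c: "c \<in> charts" "weight c p \<noteq> 0"
      and int0: "integral (cbox (- corner c) (corner c)) (integrand c f) = 0"
    by blast
  have "p \<in> closure {p. weight c p \<noteq> 0}" using c(2) by (intro subsetD[OF closure_subset]) simp
  then have p: "p \<in> fst c" "snd c p \<in> box (- corner c) (corner c)"
    using weight_support[OF c(1)] support(3)[OF c(1)] by (auto simp: support_def)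
  then have "box (- corner c) (corner c) \<noteq> {}" by blast
  then have "integrand c f (snd c p) = 0"
    using integral_cbox_eq_0_iff[OF integrand_fun_continuous[OF c(1) f] _ nn[OF c(1)]] int0 p(2)
      box_subset_cbox by blast
  moreover have "integrand c f (snd c p) = weight c p * f p * omega_power \<omega> c (snd c p)"
    using p(1) chart(5)[OF charts_sub[OF c(1)] p(1)] by (simp add: integrand_def)
  moreover have "omega_power \<omega> c (snd c p) > 0"
    using omega_power_positive[OF charts_sub[OF c(1)]] p(1) by blast
  ultimately show False using c(2) \<open>f p \<noteq> 0\<close> by simp
qed

lemma volume_nonzero: "I\<omega> (\<lambda>_. 1) \<noteq> 0"
  using integral_definite[OF smooth_fun_constant[of _ 1]] by auto

lemma has_derivative_integral:
  assumes I: "time_interval I" and t: "t \<in> I" and F: "smooth_family \<A> I F"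
  shows "((\<lambda>t. I\<omega> (F t)) has_vector_derivative I\<omega> (velocity I F t)) (at t within I)"
proof -
  note vel = has_velocity[OF atlas I F]
  have conv: "convex I" using I by (simp add: time_interval_def is_interval_convex)
  have int: "((\<lambda>t. integral (cbox (- corner c) (corner c)) (integrand c (F t))) has_vector_derivative
      integral (cbox (- corner c) (corner c)) (integrand c (velocity I F t))) (at t within I)"
    if c: "c \<in> charts" for c
  proof (rule leibniz_rule_vector_derivative[OF _ _ _ t conv])
    show "((\<lambda>t. integrand c (F t) z) has_vector_derivative integrand c (velocity I F t) z) (at t within I)"
      if "t \<in> I" for t z
      using vel(1)[OF that, of "chart_inv c z"] unfolding integrand_def
      by (auto intro!: derivative_eq_intros)
    show "integrand c (F t) integrable_on cbox (- corner c) (corner c)" if "t \<in> I" for t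
      using integrand_integrable[OF c smooth_family_slice[OF that F]] .
    show "continuous_on (I \<times> cbox (- corner c) (corner c)) (\<lambda>(t, z). integrand c (velocity I F t) z)"
      by (rule continuous_on_subset[OF integrand_continuous[OF c vel(2)]]) auto
  qed
  have "((\<lambda>t. \<Sum>c\<in>charts. integral (cbox (- corner c) (corner c)) (integrand c (F t)))
      has_vector_derivative (\<Sum>c\<in>charts. integral (cbox (- corner c) (corner c))
        (integrand c (velocity I F t)))) (at t within I)"
    by (intro has_vector_derivative_sum int)
  then show ?thesis
    unfolding integral_omega_power_boxes[OF smooth_family_slice[OF t vel(2)]]
    by (rule has_vector_derivative_transform[OF t, rotated])
      (simp add: integral_omega_power_boxes[OF smooth_family_slice[OF _ F]])
qed

lemma smooth_on_integral:
  assumes I: "time_interval I" and F: "smooth_family \<A> I F"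
  shows "smooth_on I (\<lambda>t. I\<omega> (F t))"
proof -
  have "Ck_on k I (\<lambda>t. I\<omega> (F t))" if "smooth_family \<A> I F" for k F
    using that
  proof (induction k arbitrary: F)
    case 0
    then show ?case
      using has_derivative_integral[OF I]
      by (auto simp: continuous_on_eq_continuous_within intro: has_vector_derivative_continuous)
  next
    case (Suc k)
    have "Ck_on k I (\<lambda>t. v * I\<omega> (velocity I F t))" for v
      by (intro Ck_on_mult Ck_on_const Suc.IH has_velocity(2)[OF atlas I Suc.prems])
    moreover have "((\<lambda>t. I\<omega> (F t)) has_derivative (\<lambda>v. v * I\<omega> (velocity I F t))) (at t within I)"
      if "t \<in> I" for t
      using has_derivative_integral[OF I that Suc.prems] by (simp add: has_vector_derivative_def)
    ultimately show ?case
      unfolding Ck_on.simps(2) by (intro exI[of _ "\<lambda>t v. v * I\<omega> (velocity I F t)"]) auto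
  qed
  then show ?thesis using F by (simp add: smooth_on_def)
qed


lemma smooth_fun_imp_continuous:
  assumes "smooth_fun \<A> f" shows "continuous_on UNIV f"
proof -
  have "continuous_on (fst c) f" if c: "c \<in> \<A>" for c
  proof -
    have "continuous_on (chart_image c) (f \<circ> chart_inv c)"
      using assms c unfolding smooth_fun_def by (blast intro: smooth_on_imp_continuous_on)
    then have "continuous_on (fst c) (\<lambda>p. (f \<circ> chart_inv c) (snd c p))"
      by (rule continuous_on_compose2[OF _ chart(3)[OF c]]) auto
    then show ?thesis by (rule continuous_on_eq) (simp add: chart(5)[OF c])
  qed
  then have "continuous_on (\<Union>c\<in>\<A>. fst c) f"
    using chart(1) by (intro continuous_on_open_UN) auto
  then show ?thesis using atlas by (simp add: complex_atlas_def)
qed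

lemma smooth_fun_bounded:
  assumes "smooth_fun \<A> f" obtains M where "M > 0" "\<And>p. \<bar>f p\<bar> < M"
proof -
  have "bounded (range f)"
    using compact_continuous_image[OF smooth_fun_imp_continuous[OF assms] compact]
    by (rule compact_imp_bounded)
  then obtain B where "\<And>p. \<bar>f p\<bar> \<le> B" by (auto simp: bounded_iff)
  then have "\<bar>f p\<bar> < \<bar>B\<bar> + 1" for p using abs_ge_self[of B] by (meson le_less_trans less_add_one order_trans)
  then show thesis by (intro that[of "\<bar>B\<bar> + 1"]) auto
qed

lemma integral_nonneg:
  assumes "smooth_fun \<A> f" "\<And>p. f p \<ge> 0" shows "I\<omega> f \<ge> 0"
proof -
  have "integrand c f z \<ge> 0" if "c \<in> charts" for c z
    using weight_nonneg[OF that] assms(2) omega_power_positive[OF charts_sub[OF that]]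
    by (auto simp: integrand_def less_imp_le)
  then show ?thesis
    unfolding integral_omega_power_boxes[OF assms(1)]
    by (intro sum_nonneg Henstock_Kurzweil_Integration.integral_nonneg
        integrand_integrable assms(1)) auto
qed

lemma volume_pos: "I\<omega> (\<lambda>_. 1) > 0"
  using integral_nonneg[OF smooth_fun_constant[of _ 1]] volume_nonzero by simp

section \<open>Conformal factors, curves and fields\<close>

lemma conformal_factorD:
  assumes "F \<in> conformal_factors \<A> \<omega>"
  shows "smooth_fun \<A> F" "F p > 0" "I\<omega> F = I\<omega> (\<lambda>_. 1)"
  using assms by (auto simp: conformal_factors_def)

lemma tangent_factorD:
  assumes "G \<in> tangent_factors \<A> \<omega>" shows "smooth_fun \<A> G" "I\<omega> G = 0"
  using assms by (auto simp: tangent_factors_def)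

lemma tangent_factors_add:
  "X \<in> tangent_factors \<A> \<omega> \<Longrightarrow> Y \<in> tangent_factors \<A> \<omega> \<Longrightarrow>
   (\<lambda>p. X p + Y p) \<in> tangent_factors \<A> \<omega>"
  by (simp add: tangent_factors_def smooth_fun_add integral_add)

lemma tangent_factors_cmult:
  "X \<in> tangent_factors \<A> \<omega> \<Longrightarrow> (\<lambda>p. a * X p) \<in> tangent_factors \<A> \<omega>"
  by (simp add: tangent_factors_def smooth_fun_cmult integral_cmult)

lemma tangent_factors_diff:
  "X \<in> tangent_factors \<A> \<omega> \<Longrightarrow> Y \<in> tangent_factors \<A> \<omega> \<Longrightarrow>
   (\<lambda>p. X p - Y p) \<in> tangent_factors \<A> \<omega>"
  by (simp add: tangent_factors_def smooth_fun_diff integral_diff)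

lemma conformal_factors_add_tangent:
  assumes "F \<in> conformal_factors \<A> \<omega>" "G \<in> tangent_factors \<A> \<omega>" "\<And>p. F p + t * G p > 0"
  shows "(\<lambda>p. F p + t * G p) \<in> conformal_factors \<A> \<omega>"
  using assms conformal_factorD[OF assms(1)] tangent_factorD[OF assms(2)]
  by (simp add: conformal_factors_def smooth_fun_add smooth_fun_cmult integral_add integral_cmult)

text \<open>By compactness \<open>G / F\<close> is bounded. Adding to \<open>F\<close> a small multiple of \<open>G\<close>
  thus preserves positivity.\<close>

lemma conformal_factor_dominates:
  assumes "F \<in> conformal_factors \<A> \<omega>" "smooth_fun \<A> G"
  obtains M where "M > 0" "\<And>p. \<bar>G p\<bar> < M * F p"
proof -
  note F = conformal_factorD[OF assms(1)]
  have "smooth_fun \<A> (\<lambda>p. G p * inverse (F p))"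
    using F(1,2) by (intro smooth_fun_mult smooth_fun_inverse assms(2)) (auto simp: less_imp_neq[THEN not_sym])
  then obtain M where M: "M > 0" "\<And>p. \<bar>G p * inverse (F p)\<bar> < M"
    using smooth_fun_bounded by blast
  have "\<bar>G p\<bar> < M * F p" for p
    using M(2)[of p] F(2)[of p] by (simp add: abs_mult divide_inverse[symmetric] divide_less_eq)
  then show thesis using that M(1) by blast
qed

lemma smooth_curveD:
  assumes "smooth_curve \<A> \<omega> I F"
  shows "time_interval I" "smooth_family \<A> I F" "t \<in> I \<Longrightarrow> F t \<in> conformal_factors \<A> \<omega>"
  using assms by (auto simp: smooth_curve_def)

lemma smooth_fieldD:
  assumes "smooth_field \<A> \<omega> I V"
  shows "smooth_family \<A> I V" "t \<in> I \<Longrightarrow> V t \<in> tangent_factors \<A> \<omega>"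
  using assms by (auto simp: smooth_field_def)

lemma smooth_field_cong:
  assumes "\<And>t. t \<in> I \<Longrightarrow> V t = W t" "smooth_field \<A> \<omega> I V" shows "smooth_field \<A> \<omega> I W"
  using assms smooth_family_cong[of I V W \<A>] by (simp add: smooth_field_def)

lemma smooth_field_const: "G \<in> tangent_factors \<A> \<omega> \<Longrightarrow> smooth_field \<A> \<omega> I (\<lambda>_. G)"
  by (simp add: smooth_field_def smooth_family_const tangent_factorD)

lemma smooth_field_add:
  "smooth_field \<A> \<omega> I V \<Longrightarrow> smooth_field \<A> \<omega> I W \<Longrightarrow> smooth_field \<A> \<omega> I (\<lambda>t p. V t p + W t p)"
  by (simp add: smooth_field_def smooth_family_add tangent_factors_add)

lemma smooth_field_diff:
  "smooth_field \<A> \<omega> I V \<Longrightarrow> smooth_field \<A> \<omega> I W \<Longrightarrow> smooth_field \<A> \<omega> I (\<lambda>t p. V t p - W t p)"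
  by (simp add: smooth_field_def smooth_family_diff tangent_factors_diff)

lemma smooth_field_scale:
  "smooth_on I h \<Longrightarrow> smooth_field \<A> \<omega> I V \<Longrightarrow> smooth_field \<A> \<omega> I (\<lambda>t p. h t * V t p)"
  by (simp add: smooth_field_def smooth_family_mult smooth_family_scalar tangent_factors_cmult)

text \<open>Velocities integrate to zero because the total integral along the curve is constant.\<close>

lemma smooth_field_velocity_const_integral:
  assumes I: "time_interval I" and F: "smooth_family \<A> I F" and const: "\<And>t. t \<in> I \<Longrightarrow> I\<omega> (F t) = k"
  shows "smooth_field \<A> \<omega> I (velocity I F)"
proof -
  note vel = has_velocity(2)[OF atlas I F]
  have "I\<omega> (velocity I F t) = 0" if t: "t \<in> I" for t
  proof (rule vector_derivative_unique_time_interval[OF I t])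
    show "((\<lambda>t. I\<omega> (F t)) has_vector_derivative I\<omega> (velocity I F t)) (at t within I)"
      by (rule has_derivative_integral[OF I t F])
    show "((\<lambda>t. I\<omega> (F t)) has_vector_derivative 0) (at t within I)"
      by (rule has_vector_derivative_transform[OF t, of _ "\<lambda>_. k"]) (auto simp: const)
  qed
  then show ?thesis
    using vel smooth_family_slice[OF _ vel] by (simp add: smooth_field_def tangent_factors_def)
qed

lemma smooth_field_velocity_curve:
  "smooth_curve \<A> \<omega> I F \<Longrightarrow> smooth_field \<A> \<omega> I (velocity I F)"
  by (rule smooth_field_velocity_const_integral[of _ _ "I\<omega> (\<lambda>_. 1)"])
    (auto dest: smooth_curveD intro: conformal_factorD(3))

lemma smooth_field_velocity_field:
  "time_interval I \<Longrightarrow> smooth_field \<A> \<omega> I V \<Longrightarrow> smooth_field \<A> \<omega> I (velocity I V)"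
  by (rule smooth_field_velocity_const_integral[of _ _ 0])
    (auto dest: smooth_fieldD intro: tangent_factorD(2))

lemma smooth_field_has_velocity:
  "time_interval I \<Longrightarrow> smooth_field \<A> \<omega> I V \<Longrightarrow> t \<in> I \<Longrightarrow>
   ((\<lambda>t. V t p) has_vector_derivative velocity I V t p) (at t within I)"
  by (intro has_velocity(1)[OF atlas]) (auto dest: smooth_fieldD)

lemma velocity_affine:
  assumes "time_interval I" "t \<in> I" shows "velocity I (\<lambda>t p. F p + t * G p) t = G"
  using assms by (intro ext velocity_eqI) (auto intro!: derivative_eq_intros)

lemma smooth_curve_affine:
  assumes F: "F \<in> conformal_factors \<A> \<omega>" and G: "G \<in> tangent_factors \<A> \<omega>"
    and I: "time_interval I" and pos: "\<And>t p. t \<in> I \<Longrightarrow> F p + t * G p > 0"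
  shows "smooth_curve \<A> \<omega> I (\<lambda>t p. F p + t * G p)"
proof -
  have "smooth_family \<A> I (\<lambda>t p. F p + t * G p)"
    using smooth_on_bounded_linear[OF bounded_linear_ident, of I]
    by (intro smooth_family_add smooth_family_mult smooth_family_const smooth_family_scalar
        conformal_factorD[OF F] tangent_factorD[OF G])
  then show ?thesis
    using I conformal_factors_add_tangent[OF F G pos] by (simp add: smooth_curve_def)
qed

section \<open>Existence of the Levi-Civita derivative\<close>

abbreviation g :: "'a factor_metric" where "g \<equiv> constant_weight_metric \<A> \<omega>"

definition time_derivative :: "'a covariant_derivative" where
  "time_derivative I F V t =
     (if smooth_curve \<A> \<omega> I F \<and> smooth_field \<A> \<omega> I V \<and> t \<in> I then velocity I V t else (\<lambda>_. 0))"

lemma metric_product_rule: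
  assumes I: "time_interval I" and V: "smooth_field \<A> \<omega> I V" and W: "smooth_field \<A> \<omega> I W"
    and t: "t \<in> I"
  shows "((\<lambda>s. g (F s) (V s) (W s)) has_real_derivative
      g (F t) (velocity I V t) (W t) + g (F t) (V t) (velocity I W t)) (at t within I)"
proof -
  let ?VW = "\<lambda>t p. V t p * W t p"
  note V' = smooth_field_velocity_field[OF I V] and W' = smooth_field_velocity_field[OF I W]
  have "velocity I ?VW t p = velocity I V t p * W t p + V t p * velocity I W t p" for p
    using smooth_field_has_velocity[OF I V t, of p] smooth_field_has_velocity[OF I W t, of p]
    by (intro velocity_eqI[OF I t]) (auto intro!: derivative_eq_intros)
  then have vel: "velocity I ?VW t = (\<lambda>p. velocity I V t p * W t p + V t p * velocity I W t p)"
    by blast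
  have "smooth_fun \<A> (\<lambda>p. velocity I V t p * W t p)" "smooth_fun \<A> (\<lambda>p. V t p * velocity I W t p)"
    by (intro smooth_fun_mult tangent_factorD smooth_fieldD(2)[OF _ t] V W V' W')+
  then have "I\<omega> (velocity I ?VW t) =
      I\<omega> (\<lambda>p. velocity I V t p * W t p) + I\<omega> (\<lambda>p. V t p * velocity I W t p)"
    unfolding vel by (rule integral_add)
  moreover have "((\<lambda>t. I\<omega> (?VW t)) has_vector_derivative I\<omega> (velocity I ?VW t)) (at t within I)"
    by (intro has_derivative_integral[OF I t] smooth_family_mult smooth_fieldD[OF V] smooth_fieldD[OF W])
  ultimately have "((\<lambda>t. I\<omega> (?VW t) / fact CARD('n)) has_vector_derivative
      (I\<omega> (\<lambda>p. velocity I V t p * W t p) + I\<omega> (\<lambda>p. V t p * velocity I W t p)) / fact CARD('n))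
      (at t within I)"
    by (intro has_vector_derivative_divide) simp
  then show ?thesis
    by (simp add: constant_weight_metric_def has_real_derivative_iff_has_vector_derivative
        add_divide_distrib)
qed

text \<open>In the torsion identity for a two-parameter family, both sides are derivatives of smooth
  fields along smooth curves.\<close>

lemma torsion_free_fields:
  assumes I: "time_interval I" and J: "time_interval J"
    and F: "smooth_family \<A> (I \<times> J) (\<lambda>(t, s). F t s)"
    and C: "\<And>t s. t \<in> I \<Longrightarrow> s \<in> J \<Longrightarrow> F t s \<in> conformal_factors \<A> \<omega>"
    and s: "s \<in> J"
  shows "smooth_curve \<A> \<omega> I (\<lambda>t. F t s)" "smooth_field \<A> \<omega> I (\<lambda>t. velocity J (F t) s)"
proof -
  show "smooth_curve \<A> \<omega> I (\<lambda>t. F t s)"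
    using I smooth_family_slices(2)[OF F s] C s by (simp add: smooth_curve_def)
  have "velocity J (F t) s \<in> tangent_factors \<A> \<omega>" if "t \<in> I" for t
  proof -
    have "smooth_curve \<A> \<omega> J (F t)"
      using J smooth_family_slices(1)[OF F that] C that by (simp add: smooth_curve_def)
    then show ?thesis using smooth_field_velocity_curve smooth_fieldD(2) s by blast
  qed
  then show "smooth_field \<A> \<omega> I (\<lambda>t. velocity J (F t) s)"
    using smooth_family_slices(2)[OF smooth_family_partial_velocity[OF atlas I J F] s]
    by (simp add: smooth_field_def)
qed

lemma torsion_free_fields':
  assumes I: "time_interval I" and J: "time_interval J"
    and F: "smooth_family \<A> (I \<times> J) (\<lambda>(t, s). F t s)"
    and C: "\<And>t s. t \<in> I \<Longrightarrow> s \<in> J \<Longrightarrow> F t s \<in> conformal_factors \<A> \<omega>"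
    and t: "t \<in> I"
  shows "smooth_curve \<A> \<omega> J (F t)" "smooth_field \<A> \<omega> J (\<lambda>s. velocity I (\<lambda>t. F t s) t)"
  using torsion_free_fields[OF J I smooth_family_swap[OF F] C t] by simp_all

lemma time_derivative_levi_civita: "is_levi_civita \<A> \<omega> g time_derivative"
  unfolding is_levi_civita_def
proof (intro conjI allI impI)
  fix I F V assume FV: "smooth_curve \<A> \<omega> I F \<and> smooth_field \<A> \<omega> I V"
  then have "smooth_field \<A> \<omega> I (velocity I V)"
    using smooth_field_velocity_field smooth_curveD(1) by blast
  then show "smooth_field \<A> \<omega> I (time_derivative I F V)"
    by (rule smooth_field_cong[rotated]) (simp add: time_derivative_def FV)
next
  show "additive_derivative \<A> \<omega> time_derivative"
    unfolding additive_derivative_def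
  proof (intro allI impI ballI)
    fix I F V W t p
    assume *: "smooth_curve \<A> \<omega> I F \<and> smooth_field \<A> \<omega> I V \<and> smooth_field \<A> \<omega> I W" and t: "t \<in> I"
    then have I: "time_interval I" and VW: "smooth_field \<A> \<omega> I (\<lambda>s q. V s q + W s q)"
      using smooth_curveD(1)[of I F] smooth_field_add by simp_all
    have "velocity I (\<lambda>s q. V s q + W s q) t p = velocity I V t p + velocity I W t p"
      using * t smooth_field_has_velocity[OF I]
      by (intro velocity_eqI[OF I t] has_vector_derivative_add) auto
    then show "time_derivative I F (\<lambda>s q. V s q + W s q) t p =
        time_derivative I F V t p + time_derivative I F W t p"
      using * t VW by (simp add: time_derivative_def)
  qed
next
  show "leibniz_derivative \<A> \<omega> time_derivative"
    unfolding leibniz_derivative_def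
  proof (intro allI impI ballI)
    fix I F V h t p
    assume *: "smooth_curve \<A> \<omega> I F \<and> smooth_field \<A> \<omega> I V \<and> smooth_on I h" and t: "t \<in> I"
    then have I: "time_interval I" and hV: "smooth_field \<A> \<omega> I (\<lambda>s q. h s * V s q)"
      using smooth_curveD(1)[of I F] smooth_field_scale by simp_all
    obtain h' where "(h has_derivative h' t) (at t within I)"
      using smooth_on_derivative[OF axis_movable_time_interval[OF I], of h] * t by metis
    then have "(h has_vector_derivative vector_derivative h (at t within I)) (at t within I)"
      unfolding vector_derivative_works[symmetric] by (rule differentiableI)
    then have "velocity I (\<lambda>s q. h s * V s q) t p =
        vector_derivative h (at t within I) * V t p + h t * velocity I V t p"
      using * smooth_field_has_velocity[OF I _ t, of V p]
      by (intro velocity_eqI[OF I t]) (auto intro!: derivative_eq_intros)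
    then show "time_derivative I F (\<lambda>s q. h s * V s q) t p =
        vector_derivative h (at t within I) * V t p + h t * time_derivative I F V t p"
      using * t hV by (simp add: time_derivative_def)
  qed
next
  show "metric_derivative \<A> \<omega> g time_derivative"
    unfolding metric_derivative_def
  proof (intro allI impI ballI)
    fix I F V W t
    assume *: "smooth_curve \<A> \<omega> I F \<and> smooth_field \<A> \<omega> I V \<and> smooth_field \<A> \<omega> I W" and t: "t \<in> I"
    then have I: "time_interval I" using smooth_curveD(1)[of I F] by simp
    show "((\<lambda>s. g (F s) (V s) (W s)) has_real_derivative
        g (F t) (time_derivative I F V t) (W t) + g (F t) (V t) (time_derivative I F W t)) (at t within I)"
      using metric_product_rule[OF I _ _ t, of V W F] * t by (simp add: time_derivative_def)
  qed
next
  show "torsion_free_derivative \<A> \<omega> time_derivative"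
    unfolding torsion_free_derivative_def
  proof (intro allI impI ballI)
    fix I J F t s
    assume *: "time_interval I \<and> time_interval J \<and> smooth_family \<A> (I \<times> J) (\<lambda>(t, s). F t s) \<and>
      (\<forall>t\<in>I. \<forall>s\<in>J. F t s \<in> conformal_factors \<A> \<omega>)" and ts: "t \<in> I" "s \<in> J"
    then have IJ: "time_interval I" "time_interval J" "smooth_family \<A> (I \<times> J) (\<lambda>(t, s). F t s)"
      and C: "\<And>t s. t \<in> I \<Longrightarrow> s \<in> J \<Longrightarrow> F t s \<in> conformal_factors \<A> \<omega>" by auto
    have "velocity I (\<lambda>t'. velocity J (F t') s) t = velocity J (\<lambda>s'. velocity I (\<lambda>t'. F t' s') t) s"
      using velocity_commute[OF atlas IJ ts] by blast
    then show "time_derivative I (\<lambda>t'. F t' s) (\<lambda>t'. velocity J (F t') s) t =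
        time_derivative J (F t) (\<lambda>s'. velocity I (\<lambda>t'. F t' s') t) s"
      using torsion_free_fields[OF IJ C ts(2)] torsion_free_fields'[OF IJ C ts(1)] ts
      by (simp add: time_derivative_def)
  qed
next
  fix I F V t assume "\<not> (smooth_curve \<A> \<omega> I F \<and> smooth_field \<A> \<omega> I V \<and> t \<in> I)"
  then show "time_derivative I F V t = (\<lambda>_. 0)" unfolding time_derivative_def by (rule if_not_P)
qed

section \<open>Uniqueness of the Levi-Civita derivative\<close>


lemma time_interval_symmetric: "e > 0 \<Longrightarrow> time_interval {-e..e}"
  by (simp add: time_interval_def is_interval_cc)

definition difference :: "'a covariant_derivative \<Rightarrow> 'a covariant_derivative" where
  "difference D I F V t p = D I F V t p - velocity I V t p"

context
  fixes D :: "'a covariant_derivative"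
  assumes LC: "is_levi_civita \<A> \<omega> g D"
begin

abbreviation A :: "'a covariant_derivative" where "A \<equiv> difference D"

lemma smooth_field_difference:
  assumes "smooth_curve \<A> \<omega> I F" "smooth_field \<A> \<omega> I V" shows "smooth_field \<A> \<omega> I (A I F V)"
proof -
  have "smooth_field \<A> \<omega> I (D I F V)" using LC assms unfolding is_levi_civita_def by blast
  from smooth_field_diff[OF this smooth_field_velocity_field[OF smooth_curveD(1)[OF assms(1)] assms(2)]]
  show ?thesis unfolding difference_def .
qed

lemma difference_skew:
  assumes F: "smooth_curve \<A> \<omega> I F" and V: "smooth_field \<A> \<omega> I V" and W: "smooth_field \<A> \<omega> I W"
    and t: "t \<in> I"
  shows "I\<omega> (\<lambda>p. A I F V t p * W t p) = - I\<omega> (\<lambda>p. V t p * A I F W t p)"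
proof -
  note I = smooth_curveD(1)[OF F]
  have smooth: "smooth_fun \<A> (X t)" if "smooth_field \<A> \<omega> I X" for X
    using tangent_factorD(1)[OF smooth_fieldD(2)[OF that t]] .
  have DF: "smooth_field \<A> \<omega> I (D I F X)" if "smooth_field \<A> \<omega> I X" for X
    using LC F that unfolding is_levi_civita_def by blast
  note sm = smooth[OF V] smooth[OF W] smooth[OF DF[OF V]] smooth[OF DF[OF W]]
    smooth[OF smooth_field_velocity_field[OF I V]] smooth[OF smooth_field_velocity_field[OF I W]]
  have "metric_derivative \<A> \<omega> g D" using LC unfolding is_levi_civita_def by blast
  then have "((\<lambda>s. g (F s) (V s) (W s)) has_real_derivative
      g (F t) (D I F V t) (W t) + g (F t) (V t) (D I F W t)) (at t within I)"
    using F V W t unfolding metric_derivative_def by blast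
  then have "g (F t) (D I F V t) (W t) + g (F t) (V t) (D I F W t) =
      g (F t) (velocity I V t) (W t) + g (F t) (V t) (velocity I W t)"
    using metric_product_rule[OF I V W t, of F] vector_derivative_unique_time_interval[OF I t]
    unfolding has_real_derivative_iff_has_vector_derivative by blast
  then have "I\<omega> (\<lambda>p. D I F V t p * W t p) + I\<omega> (\<lambda>p. V t p * D I F W t p) =
      I\<omega> (\<lambda>p. velocity I V t p * W t p) + I\<omega> (\<lambda>p. V t p * velocity I W t p)"
    by (simp add: constant_weight_metric_def add_divide_distrib[symmetric])
  moreover have "I\<omega> (\<lambda>p. A I F V t p * W t p) =
      I\<omega> (\<lambda>p. D I F V t p * W t p) - I\<omega> (\<lambda>p. velocity I V t p * W t p)"
    using integral_diff[of "\<lambda>p. D I F V t p * W t p" "\<lambda>p. velocity I V t p * W t p"] sm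
    by (simp add: difference_def left_diff_distrib smooth_fun_mult)
  moreover have "I\<omega> (\<lambda>p. V t p * A I F W t p) =
      I\<omega> (\<lambda>p. V t p * D I F W t p) - I\<omega> (\<lambda>p. V t p * velocity I W t p)"
    using integral_diff[of "\<lambda>p. V t p * D I F W t p" "\<lambda>p. V t p * velocity I W t p"] sm
    by (simp add: difference_def right_diff_distrib smooth_fun_mult)
  ultimately show ?thesis by simp
qed

text \<open>Skew symmetry makes the difference tensorial: paired with its own value, the change
  of \<open>A V\<close> under a change of \<open>V\<close> can be shifted to a factor that only involves \<open>V t\<close>.\<close>

lemma difference_tensorial:
  assumes F: "smooth_curve \<A> \<omega> I F" and V: "smooth_field \<A> \<omega> I V" and W: "smooth_field \<A> \<omega> I W"
    and t: "t \<in> I" and eq: "V t = W t"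
  shows "A I F V t = A I F W t"
proof
  fix p
  define U where "U s q = A I F V s q - A I F W s q" for s q
  note AV = smooth_field_difference[OF F V] and AW = smooth_field_difference[OF F W]
  have U: "smooth_field \<A> \<omega> I U"
    using smooth_field_diff[OF AV AW] unfolding U_def .
  have smooth: "smooth_fun \<A> (X t)" if "smooth_field \<A> \<omega> I X" for X
    using tangent_factorD(1)[OF smooth_fieldD(2)[OF that t]] .
  have "I\<omega> (\<lambda>q. A I F V t q * U t q) = I\<omega> (\<lambda>q. A I F W t q * U t q)"
    using difference_skew[OF F V U t] difference_skew[OF F W U t] eq by simp
  moreover have "(\<lambda>q. U t q * U t q) = (\<lambda>q. A I F V t q * U t q - A I F W t q * U t q)"
    by (simp add: U_def left_diff_distrib)
  ultimately have "I\<omega> (\<lambda>q. U t q * U t q) = 0"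
    using smooth[OF AV] smooth[OF AW] smooth[OF U] by (simp add: integral_diff smooth_fun_mult)
  then have "U t p * U t p = 0"
    using smooth[OF U] by (intro integral_definite[of "\<lambda>q. U t q * U t q"]) (auto intro: smooth_fun_mult)
  then show "A I F V t p = A I F W t p" by (simp add: U_def)
qed

text \<open>Torsion freeness is applied to a variation of the whole curve \<open>F\<close> with direction \<open>Y\<close> at
  time \<open>t0\<close>. If \<open>I\<close> is not compact, \<open>F t + s Y\<close> may fail to be positive for some \<open>t\<close> however
  small \<open>s\<close> is. The factor \<open>1 + s (H - c t)\<close> with a bounded function \<open>H\<close> avoids this; subtracting
  the mean \<open>c t\<close> of \<open>H\<close> with respect to \<open>F t \<omega>\<^sup>n\<close> keeps the total volume fixed.\<close>

lemma difference_variation: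
  assumes F: "smooth_curve \<A> \<omega> I F" and t0: "t0 \<in> I" and Y: "Y \<in> tangent_factors \<A> \<omega>"
    and M: "\<And>p. \<bar>Y p\<bar> < M * F t0 p" and e: "e > 0" "2 * M * e < 1"
  shows "A I F (\<lambda>_. Y) t0 =
    A {-e..e} (\<lambda>s p. F t0 p + s * Y p) (\<lambda>_. velocity I F t0) 0"
proof -
  note I = smooth_curveD(1)[OF F] and Fs = smooth_curveD(2)[OF F] and FC = smooth_curveD(3)[OF F]
  define J where "J = {-e..e}"
  have J: "time_interval J" and zero_J: "0 \<in> J"
    using e(1) time_interval_symmetric by (auto simp: J_def)
  define H where "H p = Y p * inverse (F t0 p)" for p
  have H_smooth: "smooth_fun \<A> H"
    unfolding H_def using conformal_factorD(1,2)[OF FC[OF t0]] tangent_factorD(1)[OF Y]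
    by (intro smooth_fun_mult smooth_fun_inverse) (auto simp: less_imp_neq[THEN not_sym])
  have FH: "F t0 p * H p = Y p" for p
    using conformal_factorD(2)[OF FC[OF t0], of p] by (simp add: H_def)
  have H_bound: "\<bar>H p\<bar> \<le> M" for p
    using M[of p] conformal_factorD(2)[OF FC[OF t0], of p]
    by (simp add: H_def abs_mult divide_inverse[symmetric] divide_le_eq)
  define c where "c = (\<lambda>t. I\<omega> (\<lambda>p. F t p * H p) / I\<omega> (\<lambda>_. 1))"
  have c_smooth: "smooth_on I c"
  proof -
    have "smooth_on I (\<lambda>t. I\<omega> (\<lambda>p. F t p * H p))"
      by (intro smooth_on_integral[OF I] smooth_family_mult Fs smooth_family_const H_smooth)
    from smooth_on_mult[OF this smooth_on_const[of I "inverse (I\<omega> (\<lambda>_. 1))"]]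
    show ?thesis unfolding c_def divide_inverse .
  qed
  have c_t0: "c t0 = 0" by (simp add: c_def FH tangent_factorD(2)[OF Y])
  have c_bound: "\<bar>c t\<bar> \<le> M" if t: "t \<in> I" for t
  proof -
    note Ft = conformal_factorD[OF FC[OF t]]
    have sm: "smooth_fun \<A> (\<lambda>p. F t p * H p)" by (intro smooth_fun_mult Ft H_smooth)
    have nonneg: "0 \<le> M * F t p - F t p * H p" "0 \<le> F t p * H p - (- M) * F t p" for p
      using H_bound[of p] Ft(2)[of p] mult_left_mono[of "H p" M "F t p"]
        mult_left_mono[of "- M" "H p" "F t p"] by (auto simp: abs_le_iff algebra_simps)
    have "0 \<le> M * I\<omega> (F t) - I\<omega> (\<lambda>p. F t p * H p)"
      using integral_nonneg[OF smooth_fun_diff[OF smooth_fun_cmult[OF Ft(1)] sm] nonneg(1)]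
      unfolding integral_diff[OF smooth_fun_cmult[OF Ft(1)] sm] integral_cmult[OF Ft(1)] .
    moreover have "0 \<le> I\<omega> (\<lambda>p. F t p * H p) - (- M) * I\<omega> (F t)"
      using integral_nonneg[OF smooth_fun_diff[OF sm smooth_fun_cmult[OF Ft(1)]] nonneg(2)]
      unfolding integral_diff[OF sm smooth_fun_cmult[OF Ft(1)]] integral_cmult[OF Ft(1)] .
    ultimately have "I\<omega> (\<lambda>p. F t p * H p) \<le> M * I\<omega> (\<lambda>_. 1)"
        "- M * I\<omega> (\<lambda>_. 1) \<le> I\<omega> (\<lambda>p. F t p * H p)"
      unfolding Ft(3) by simp_all
    then show ?thesis using volume_pos by (simp add: c_def abs_le_iff divide_le_eq le_divide_eq)
  qed
  define \<Phi> where "\<Phi> t s p = F t p * (1 + s * (H p - c t))" for t s p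
  have \<Phi>_smooth: "smooth_family \<A> (I \<times> J) (\<lambda>(t, s). \<Phi> t s)"
  proof -
    have "smooth_family \<A> (I \<times> J) (\<lambda>x. F (fst x))"
      using smooth_family_reparametrize[OF bounded_linear_fst _ Fs, of "I \<times> J" 0] by auto
    moreover have "smooth_on (I \<times> J) snd"
      by (intro smooth_on_bounded_linear bounded_linear_snd)
    moreover have "smooth_on (I \<times> J) (\<lambda>x. c (fst x))"
      using smooth_on_compose_affine[OF bounded_linear_fst _ c_smooth, of "I \<times> J" 0] by auto
    ultimately have "smooth_family \<A> (I \<times> J) (\<lambda>x p. F (fst x) p * (1 + snd x * (H p - c (fst x))))"
      by (intro smooth_family_mult smooth_family_add smooth_family_diff
          smooth_family_const[OF smooth_fun_constant] smooth_family_const[OF H_smooth]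
          smooth_family_scalar)
    then show ?thesis by (simp add: \<Phi>_def[abs_def] case_prod_beta')
  qed
  have \<Phi>_C: "\<Phi> t s \<in> conformal_factors \<A> \<omega>" if t: "t \<in> I" and s: "s \<in> J" for t s
  proof -
    note Ft = conformal_factorD[OF FC[OF t]]
    have sm: "smooth_fun \<A> (\<lambda>p. F t p * H p)" by (intro smooth_fun_mult Ft H_smooth)
    have pos: "\<Phi> t s p > 0" for p
    proof -
      have "\<bar>s * (H p - c t)\<bar> \<le> e * (2 * M)"
        unfolding abs_mult using s H_bound[of p] c_bound[OF t]
        by (intro mult_mono) (auto simp: J_def)
      then have "1 + s * (H p - c t) > 0" using e(2) by (simp add: abs_le_iff algebra_simps)
      then show ?thesis using Ft(2) by (simp add: \<Phi>_def)
    qed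
    have tangent: "(\<lambda>p. F t p * H p - c t * F t p) \<in> tangent_factors \<A> \<omega>"
    proof -
      have "I\<omega> (\<lambda>p. F t p * H p - c t * F t p) = I\<omega> (\<lambda>p. F t p * H p) - c t * I\<omega> (F t)"
        unfolding integral_diff[OF sm smooth_fun_cmult[OF Ft(1)]] integral_cmult[OF Ft(1)] ..
      also have "\<dots> = 0" unfolding Ft(3) c_def using volume_nonzero by simp
      finally show ?thesis
        using smooth_fun_diff[OF sm smooth_fun_cmult[OF Ft(1)]] by (simp add: tangent_factors_def)
    qed
    have eq: "\<Phi> t s = (\<lambda>p. F t p + s * (F t p * H p - c t * F t p))"
      by (simp add: \<Phi>_def algebra_simps fun_eq_iff)
    show ?thesis
      using conformal_factors_add_tangent[OF FC[OF t] tangent, of s] pos unfolding eq by blast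
  qed
  define V where "V t = velocity J (\<Phi> t) 0" for t
  define W where "W s = velocity I (\<lambda>t. \<Phi> t s) t0" for s
  have \<Phi>_0: "(\<lambda>t. \<Phi> t 0) = F" by (simp add: \<Phi>_def fun_eq_iff)
  have \<Phi>_t0: "\<Phi> t0 = (\<lambda>s p. F t0 p + s * Y p)"
    using FH by (simp add: \<Phi>_def c_t0 fun_eq_iff distrib_left mult.left_commute)
  have V_t0: "V t0 = Y" unfolding V_def \<Phi>_t0 by (rule velocity_affine[OF J zero_J])
  have W_0: "W 0 = velocity I F t0" unfolding W_def \<Phi>_0 ..
  have V: "smooth_field \<A> \<omega> I V"
    using torsion_free_fields(2)[OF I J \<Phi>_smooth \<Phi>_C zero_J] unfolding V_def .
  have line: "smooth_curve \<A> \<omega> J (\<lambda>s p. F t0 p + s * Y p)" and W: "smooth_field \<A> \<omega> J W"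
    using torsion_free_fields'[OF I J \<Phi>_smooth \<Phi>_C t0] unfolding W_def \<Phi>_t0 by auto
  have "torsion_free_derivative \<A> \<omega> D" using LC unfolding is_levi_civita_def by blast
  then have "D I (\<lambda>t. \<Phi> t 0) V t0 = D J (\<Phi> t0) W 0"
    using I J \<Phi>_smooth \<Phi>_C t0 zero_J unfolding torsion_free_derivative_def V_def W_def by blast
  moreover have "velocity I V t0 = velocity J W 0"
    using velocity_commute[OF atlas I J \<Phi>_smooth t0 zero_J] unfolding V_def W_def by blast
  ultimately have "A I F V t0 = A J (\<lambda>s p. F t0 p + s * Y p) W 0"
    by (simp add: difference_def fun_eq_iff \<Phi>_0 \<Phi>_t0)
  moreover have "A I F V t0 = A I F (\<lambda>_. Y) t0"
    by (rule difference_tensorial[OF F V smooth_field_const[OF Y] t0]) (simp add: V_t0)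
  moreover have "A J (\<lambda>s p. F t0 p + s * Y p) W 0 =
      A J (\<lambda>s p. F t0 p + s * Y p) (\<lambda>_. velocity I F t0) 0"
    using smooth_fieldD(2)[OF smooth_field_velocity_curve[OF F] t0]
    by (intro difference_tensorial[OF line W _ zero_J] smooth_field_const) (simp_all add: W_0)
  ultimately show ?thesis by (simp add: J_def)
qed

text \<open>On straight lines through \<open>P\<close> the difference defines a trilinear form that is
  symmetric in the first two arguments and skew in the last two, and so vanishes.\<close>

lemma difference_line_zero:
  assumes P: "P \<in> conformal_factors \<A> \<omega>"
    and X: "X \<in> tangent_factors \<A> \<omega>" "\<And>p. \<bar>X p\<bar> < M * P p"
    and Y: "Y \<in> tangent_factors \<A> \<omega>" "\<And>p. \<bar>Y p\<bar> < M * P p"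
    and Z: "Z \<in> tangent_factors \<A> \<omega>" "\<And>p. \<bar>Z p\<bar> < M * P p"
    and e: "e > 0" "2 * M * e < 1"
  shows "I\<omega> (\<lambda>p. A {-e..e} (\<lambda>s p. P p + s * X p) (\<lambda>_. Y) 0 p * Z p) = 0"
proof -
  define N where "N = {X \<in> tangent_factors \<A> \<omega>. \<forall>p. \<bar>X p\<bar> < M * P p}"
  define J where "J = {-e..e}"
  define \<Gamma> where "\<Gamma> X Y = A J (\<lambda>s p. P p + s * X p) (\<lambda>_. Y) 0" for X Y
  define S where "S X Y Z = I\<omega> (\<lambda>p. \<Gamma> X Y p * Z p)" for X Y Z
  have J: "time_interval J" "0 \<in> J" using e(1) time_interval_symmetric by (auto simp: J_def)
  have line: "smooth_curve \<A> \<omega> J (\<lambda>s p. P p + s * X p)" if X: "X \<in> N" for X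
  proof (rule smooth_curve_affine[OF P _ J(1)])
    show "X \<in> tangent_factors \<A> \<omega>" using X by (simp add: N_def)
    fix s p assume "s \<in> J"
    have X_p: "\<bar>X p\<bar> < M * P p" using X by (simp add: N_def)
    have "\<bar>s * X p\<bar> \<le> e * (M * P p)"
      unfolding abs_mult using \<open>s \<in> J\<close> X_p by (intro mult_mono) (auto simp: J_def)
    also have "\<dots> < P p"
    proof -
      have "M * P p > 0" using X_p by (rule le_less_trans[OF abs_ge_zero])
      then have "M > 0" using conformal_factorD(2)[OF P, of p] by (simp add: zero_less_mult_iff)
      then have "M * e < 1" using mult_pos_pos[OF _ e(1), of M] e(2) by linarith
      then show ?thesis
        using mult_strict_right_mono[of "M * e" 1 "P p"] conformal_factorD(2)[OF P, of p]
        by (simp add: ac_simps)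
    qed
    finally show "P p + s * X p > 0" by (simp add: abs_less_iff)
  qed
  have sym: "\<Gamma> X Y = \<Gamma> Y X" if XY: "X \<in> N" "Y \<in> N" for X Y
  proof -
    have "A J (\<lambda>s p. P p + s * X p) (\<lambda>_. Y) 0 =
        A {-e..e} (\<lambda>s p. (P p + 0 * X p) + s * Y p)
          (\<lambda>_. velocity J (\<lambda>s p. P p + s * X p) 0) 0"
      using XY e by (intro difference_variation[OF line[OF XY(1)] J(2), where M = M]) (auto simp: N_def)
    then show ?thesis by (simp add: \<Gamma>_def J_def[symmetric] velocity_affine[OF J])
  qed
  have skew: "S X Y Z = - S X Z Y" if "X \<in> N" "Y \<in> N" "Z \<in> N" for X Y Z
    using difference_skew[OF line[OF that(1)] smooth_field_const smooth_field_const J(2), of Y Z] that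
    by (simp add: S_def \<Gamma>_def N_def mult.commute)
  have sym': "S X Y Z = S Y X Z" if "X \<in> N" "Y \<in> N" for X Y Z
    by (simp add: S_def sym[OF that])
  have N: "X \<in> N" "Y \<in> N" "Z \<in> N" using X Y Z by (auto simp: N_def)
  \<comment> \<open>an odd number of sign changes: XYZ, YXZ, YZX, ZYX, ZXY, XZY, XYZ\<close>
  have "S X Y Z = - S X Y Z"
    using sym'[of X Y Z] skew[of Y X Z] sym'[of Y Z X] skew[of Z Y X] sym'[of Z X Y] skew[of X Z Y] N
    by simp
  then show ?thesis by (simp add: S_def \<Gamma>_def J_def)
qed

text \<open>The bound \<open>M\<close> covers the value \<open>Z\<close> of the difference itself, so that \<open>Z\<close> can be tested against
  \<open>Z\<close> on a common time interval.\<close>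

lemma difference_zero:
  assumes F: "smooth_curve \<A> \<omega> I F" and V: "smooth_field \<A> \<omega> I V" and t: "t \<in> I"
  shows "A I F V t = (\<lambda>_. 0)"
proof
  fix p
  let ?X = "velocity I F t" and ?Y = "V t" and ?Z = "A I F V t"
  note P = smooth_curveD(3)[OF F t]
  have X: "?X \<in> tangent_factors \<A> \<omega>"
    by (rule smooth_fieldD(2)[OF smooth_field_velocity_curve[OF F] t])
  have Y: "?Y \<in> tangent_factors \<A> \<omega>" by (rule smooth_fieldD(2)[OF V t])
  have Z: "?Z \<in> tangent_factors \<A> \<omega>"
    by (rule smooth_fieldD(2)[OF smooth_field_difference[OF F V] t])
  obtain M1 M2 M3 where M: "M1 > 0" "\<And>p. \<bar>?X p\<bar> < M1 * F t p" "M2 > 0" "\<And>p. \<bar>?Y p\<bar> < M2 * F t p"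
      "M3 > 0" "\<And>p. \<bar>?Z p\<bar> < M3 * F t p"
    using conformal_factor_dominates[OF P tangent_factorD(1)[OF X]]
      conformal_factor_dominates[OF P tangent_factorD(1)[OF Y]]
      conformal_factor_dominates[OF P tangent_factorD(1)[OF Z]] by metis
  define M where "M = M1 + M2 + M3"
  have le: "M1 * F t p \<le> M * F t p" "M2 * F t p \<le> M * F t p" "M3 * F t p \<le> M * F t p" for p
    using M(1,3,5) conformal_factorD(2)[OF P, of p] by (auto simp: M_def intro!: mult_right_mono)
  have bounds: "\<bar>?X p\<bar> < M * F t p" "\<bar>?Y p\<bar> < M * F t p" "\<bar>?Z p\<bar> < M * F t p" for p
    using le[of p] M(2,4,6)[of p] by linarith+
  define e where "e = 1 / (4 * M)"
  have e: "e > 0" "2 * M * e < 1" using M(1,3,5) by (auto simp: e_def M_def)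
  have "?Z = A I F (\<lambda>_. ?Y) t"
    by (rule difference_tensorial[OF F V smooth_field_const[OF Y] t refl])
  also have "\<dots> = A {-e..e} (\<lambda>s p. F t p + s * ?Y p) (\<lambda>_. ?X) 0"
    by (rule difference_variation[OF F t Y bounds(2) e])
  finally have "?Z = A {-e..e} (\<lambda>s p. F t p + s * ?Y p) (\<lambda>_. ?X) 0" .
  then have "I\<omega> (\<lambda>p. ?Z p * ?Z p) = 0"
    using difference_line_zero[OF P Y bounds(2) X bounds(1) Z bounds(3) e] by simp
  then have "?Z p * ?Z p = 0"
    using smooth_fun_mult[OF tangent_factorD(1)[OF Z] tangent_factorD(1)[OF Z]]
    by (intro integral_definite[of "\<lambda>p. ?Z p * ?Z p"]) auto
  then show "?Z p = 0" by simp
qed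

lemma levi_civita_unique: "D = time_derivative"
proof (intro ext)
  fix I F V t p
  show "D I F V t p = time_derivative I F V t p"
  proof (cases "smooth_curve \<A> \<omega> I F \<and> smooth_field \<A> \<omega> I V \<and> t \<in> I")
    case True
    then have "A I F V t p = 0" using difference_zero by (simp add: fun_eq_iff)
    then show ?thesis using True by (simp add: difference_def time_derivative_def)
  next
    case False
    then have "D I F V t = (\<lambda>_. 0)" using LC unfolding is_levi_civita_def by blast
    then show ?thesis unfolding time_derivative_def if_not_P[OF False] by simp
  qed
qed

end

lemma levi_civita_eq: "levi_civita \<A> \<omega> g = time_derivative"
  unfolding levi_civita_def
  by (rule the_equality[of "is_levi_civita \<A> \<omega> g"])
    (rule time_derivative_levi_civita, rule levi_civita_unique)

section \<open>Geodesics\<close>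

lemma geodesic_iff:
  "geodesic \<A> \<omega> g I F \<longleftrightarrow>
     smooth_curve \<A> \<omega> I F \<and> (\<forall>t\<in>I. velocity I (velocity I F) t = (\<lambda>_. 0))"
  using smooth_field_velocity_curve[of I F]
  by (auto simp: geodesic_def levi_civita_eq time_derivative_def)

lemma geodesic_affine:
  assumes "F \<in> conformal_factors \<A> \<omega>" "G \<in> tangent_factors \<A> \<omega>" and I: "time_interval I"
    and "\<And>t p. t \<in> I \<Longrightarrow> F p + t * G p > 0"
  shows "geodesic \<A> \<omega> g I (\<lambda>t p. F p + t * G p)"
proof -
  have "velocity I (velocity I (\<lambda>t p. F p + t * G p)) t = (\<lambda>_. 0)" if t: "t \<in> I" for t
  proof (intro ext velocity_eqI[OF I t])
    show "((\<lambda>t. velocity I (\<lambda>t p. F p + t * G p) t p) has_vector_derivative 0) (at t within I)" for p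
      by (rule has_vector_derivative_transform[OF t, of _ "\<lambda>_. G p"])
        (auto simp: velocity_affine[OF I])
  qed
  then show ?thesis using smooth_curve_affine[OF assms] by (simp add: geodesic_iff)
qed

lemma geodesic_imp_affine:
  assumes geo: "geodesic \<A> \<omega> g I F" and a: "a \<in> I" and t: "t \<in> I"
  shows "F t p = F a p + (t - a) * velocity I F a p"
proof -
  have F: "smooth_curve \<A> \<omega> I F" and acc: "\<And>t. t \<in> I \<Longrightarrow> velocity I (velocity I F) t = (\<lambda>_. 0)"
    using geo by (auto simp: geodesic_iff)
  note I = smooth_curveD(1)[OF F]
  have conv: "convex I" using I by (simp add: time_interval_def is_interval_convex)
  have "((\<lambda>t. velocity I F t p) has_vector_derivative 0) (at t within I)" if "t \<in> I" for t
    using smooth_field_has_velocity[OF I smooth_field_velocity_curve[OF F] that, of p] acc[OF that]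
    by simp
  then obtain v where v: "\<And>t. t \<in> I \<Longrightarrow> velocity I F t p = v"
    using has_vector_derivative_zero_constant[OF conv, of "\<lambda>t. velocity I F t p"] by metis
  have "((\<lambda>t. F t p - t * v) has_vector_derivative 0) (at t within I)" if "t \<in> I" for t
    using has_velocity(1)[OF atlas I smooth_curveD(2)[OF F] that, of p] v[OF that]
    by (auto intro!: derivative_eq_intros)
  then obtain k where "\<And>t. t \<in> I \<Longrightarrow> F t p - t * v = k"
    using has_vector_derivative_zero_constant[OF conv, of "\<lambda>t. F t p - t * v"] by blast
  then have "F t p - t * v = F a p - a * v" using a t by simp
  then show ?thesis using v[OF a] by (simp add: algebra_simps)
qed

end

theorem theorem5p5:
  fixes \<A> :: "('a::t2_space, 'n::finite) chart set" and \<omega> :: "('a, 'n) two_form"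
  assumes "compact (UNIV :: 'a set)" and "connected (UNIV :: 'a set)"
    and "kaehler_manifold \<A> \<omega>"
  defines "g \<equiv> constant_weight_metric \<A> \<omega>"
  shows
    "(\<forall>F\<^sub>0\<in>conformal_factors \<A> \<omega>. \<forall>F\<^sub>1\<in>conformal_factors \<A> \<omega>.
        (\<forall>t\<in>{0..1}. (\<lambda>p. t * F\<^sub>1 p + (1 - t) * F\<^sub>0 p) \<in> conformal_factors \<A> \<omega>) \<and>
        geodesic \<A> \<omega> g {0..1} (\<lambda>t p. t * F\<^sub>1 p + (1 - t) * F\<^sub>0 p) \<and>
        (\<forall>\<gamma>. geodesic \<A> \<omega> g {0..1} \<gamma> \<and> \<gamma> 0 = F\<^sub>0 \<and> \<gamma> 1 = F\<^sub>1 \<longrightarrow>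
           (\<forall>t\<in>{0..1}. \<gamma> t = (\<lambda>p. t * F\<^sub>1 p + (1 - t) * F\<^sub>0 p)))) \<and>
     (\<forall>F\<in>conformal_factors \<A> \<omega>. \<forall>G\<in>tangent_factors \<A> \<omega>.
        (\<exists>J. open J \<and> is_interval J \<and> 0 \<in> J \<and> (\<forall>t\<in>J. \<forall>p. F p + t * G p > 0)) \<and>
        (\<forall>J. open J \<and> is_interval J \<and> 0 \<in> J \<longrightarrow>
           ((\<forall>t\<in>J. \<forall>p. F p + t * G p > 0) \<longrightarrow>
              geodesic \<A> \<omega> g J (\<lambda>t p. F p + t * G p) \<and>
              velocity J (\<lambda>t p. F p + t * G p) 0 = G) \<and>
           (\<forall>\<gamma>. geodesic \<A> \<omega> g J \<gamma> \<and> \<gamma> 0 = F \<and> velocity J \<gamma> 0 = G \<longrightarrow>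
              (\<forall>t\<in>J. \<gamma> t = (\<lambda>p. F p + t * G p)))))"
proof (intro conjI ballI)
  interpret compact_kaehler \<A> \<omega> by standard (fact assms)+
  fix F\<^sub>0 F\<^sub>1 assume F: "F\<^sub>0 \<in> conformal_factors \<A> \<omega>" "F\<^sub>1 \<in> conformal_factors \<A> \<omega>"
  let ?G = "\<lambda>p. F\<^sub>1 p - F\<^sub>0 p"
  have seg: "(\<lambda>p. t * F\<^sub>1 p + (1 - t) * F\<^sub>0 p) = (\<lambda>p. F\<^sub>0 p + t * ?G p)" for t
    by (simp add: fun_eq_iff algebra_simps)
  have G: "?G \<in> tangent_factors \<A> \<omega>"
    using conformal_factorD[OF F(1)] conformal_factorD[OF F(2)]
    by (simp add: tangent_factors_def smooth_fun_diff integral_diff)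
  have pos: "F\<^sub>0 p + t * ?G p > 0" if "t \<in> {0..1}" for t p
  proof -
    have "(1 - t) * F\<^sub>0 p + t * F\<^sub>1 p > 0"
      using that conformal_factorD(2)[OF F(1), of p] conformal_factorD(2)[OF F(2), of p]
      by (cases "t = 0") (auto intro!: add_nonneg_pos)
    then show ?thesis by (simp add: algebra_simps)
  qed
  show "(\<lambda>p. t * F\<^sub>1 p + (1 - t) * F\<^sub>0 p) \<in> conformal_factors \<A> \<omega>" if "t \<in> {0..1}" for t
    unfolding seg using conformal_factors_add_tangent[OF F(1) G pos[OF that]] .
  have I: "time_interval {0..1}" by (simp add: time_interval_def is_interval_cc)
  show "geodesic \<A> \<omega> g {0..1} (\<lambda>t p. t * F\<^sub>1 p + (1 - t) * F\<^sub>0 p)"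
    unfolding seg g_def using geodesic_affine[OF F(1) G I pos] .
  show "\<forall>\<gamma>. geodesic \<A> \<omega> g {0..1} \<gamma> \<and> \<gamma> 0 = F\<^sub>0 \<and> \<gamma> 1 = F\<^sub>1 \<longrightarrow>
      (\<forall>t\<in>{0..1}. \<gamma> t = (\<lambda>p. t * F\<^sub>1 p + (1 - t) * F\<^sub>0 p))"
  proof (intro allI impI ballI ext)
    fix \<gamma> t p assume \<gamma>: "geodesic \<A> \<omega> g {0..1} \<gamma> \<and> \<gamma> 0 = F\<^sub>0 \<and> \<gamma> 1 = F\<^sub>1" and t: "t \<in> {0..1::real}"
    then have aff: "\<gamma> s p = \<gamma> 0 p + (s - 0) * velocity {0..1} \<gamma> 0 p" if "s \<in> {0..1}" for s
      using that unfolding g_def by (intro geodesic_imp_affine) auto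
    from aff[of 1] \<gamma> have vel: "velocity {0..1} \<gamma> 0 p = ?G p" by simp
    then show "\<gamma> t p = t * F\<^sub>1 p + (1 - t) * F\<^sub>0 p"
      using aff[OF t] \<gamma> unfolding vel by (simp add: algebra_simps)
  qed
next
  interpret compact_kaehler \<A> \<omega> by standard (fact assms)+
  fix F G assume F: "F \<in> conformal_factors \<A> \<omega>" and G: "G \<in> tangent_factors \<A> \<omega>"
  obtain M where M: "M > 0" "\<And>p. \<bar>G p\<bar> < M * F p"
    using conformal_factor_dominates[OF F tangent_factorD(1)[OF G]] by blast
  show "\<exists>J. open J \<and> is_interval J \<and> 0 \<in> J \<and> (\<forall>t\<in>J. \<forall>p. F p + t * G p > 0)"
  proof (intro exI[of _ "{- 1 / M <..< 1 / M}"] conjI ballI allI)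
    fix t p assume "t \<in> {- 1 / M <..< 1 / M}"
    then have "\<bar>t\<bar> < 1 / M" by (auto simp: abs_less_iff)
    then have "\<bar>t * G p\<bar> \<le> 1 / M * \<bar>G p\<bar>"
      unfolding abs_mult by (intro mult_right_mono) auto
    also have "\<dots> < F p" using M by (simp add: divide_less_eq mult.commute)
    finally show "F p + t * G p > 0" by (simp add: abs_less_iff)
  qed (use M(1) in \<open>auto simp: is_interval_oo\<close>)
  show "\<forall>J. open J \<and> is_interval J \<and> 0 \<in> J \<longrightarrow>
      ((\<forall>t\<in>J. \<forall>p. F p + t * G p > 0) \<longrightarrow>
         geodesic \<A> \<omega> g J (\<lambda>t p. F p + t * G p) \<and> velocity J (\<lambda>t p. F p + t * G p) 0 = G) \<and>
      (\<forall>\<gamma>. geodesic \<A> \<omega> g J \<gamma> \<and> \<gamma> 0 = F \<and> velocity J \<gamma> 0 = G \<longrightarrow>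
         (\<forall>t\<in>J. \<gamma> t = (\<lambda>p. F p + t * G p)))"
  proof (intro allI impI conjI ballI ext)
    fix J :: "real set" assume J: "open J \<and> is_interval J \<and> 0 \<in> J"
    then have tJ: "time_interval J" "0 \<in> J" by (auto simp: time_interval_def interior_open)
    show "velocity J (\<lambda>t p. F p + t * G p) 0 p = G p" for p
      by (simp add: velocity_affine[OF tJ])
    show "geodesic \<A> \<omega> g J (\<lambda>t p. F p + t * G p)" if "\<forall>t\<in>J. \<forall>p. F p + t * G p > 0"
      unfolding g_def using geodesic_affine[OF F G tJ(1)] that by blast
    show "\<gamma> t p = F p + t * G p"
      if "geodesic \<A> \<omega> g J \<gamma> \<and> \<gamma> 0 = F \<and> velocity J \<gamma> 0 = G" "t \<in> J" for \<gamma> t p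
      using geodesic_imp_affine[of J \<gamma> 0 t p] that tJ unfolding g_def by simp
  qed
qed

end
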